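(* In the setting described in the context (in particular $w,\varepsilon_k$ Gaussian; $x_k$ identically distributed with bounded support and common positive-definite covariance matrix $\overline Q$), for any $\gamma>0$, the sequence of OLL estimates $\hat w_k^\circ$, i.e. the estimates generated by the updating functions $u_k^\circ=L\,\mathbb{E}\{e_k^\circ|I_k\}$ with $L:=-(\overline K+\gamma I)^{-1}\overline K$, minimizes, among all sequences of estimates generated by admissible updating functions, the average regret functional $$\liminf_{N\to+\infty}\frac1N\,\mathbb{E}\Big\{\sum_{k=0}^{N-1}(\hat w_k'x_k-y_k)^2\Big\}-\liminf_{N\to+\infty}\frac1N\,\mathbb{E}\Big\{\sum_{k=0}^{N-1}(w'x_k-y_k)^2\Big\}.$$
   Context: A prime denotes transpose, $I$ is the $d\times d$ identity matrix. Data model: $w\in\mathbb{R}^d$ is a random vector, $x_k\in\mathbb{R}^d$ and $\varepsilon_k\in\mathbb{R}$ ($k=0,1,\dots$) are random inputs and noises; the random variables $w,\{x_k\},\{\varepsilon_k\}$ are mutually independent and have mean $0$; $w$ has covariance matrix $\Sigma_w$ and the $\varepsilon_k$ have the same variance $\sigma_\varepsilon^2>0$; $w$ and the $\varepsilon_k$ are Gaussian; the $x_k$ are identically distributed, their common probability distribution has bounded support, and $\mathbb{E}\{x_kx_k'\}=\overline Q$ is positive-definite. The outputs are $y_k=w'x_k+\varepsilon_k$. Learning machine and admissible updating functions: $\hat w_0:=0$, $\hat w_{k+1}=\hat w_k+u_k$ for $k=0,1,\dots$, where the update $u_k\in\mathbb{R}^d$ is a function $u_k(I_k)$ of the information vector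 $I_k:=\{(x_j,y_j),\ j=0,\dots,k;\ u_j,\ j=0,\dots,k-1\}$ ($I_0:=\{(x_0,y_0)\}$). The error is $e_k:=\hat w_k-w$; $e_k^\circ$ is the error when the updating functions $u_k^\circ$ are applied, so that $\hat w_0^\circ=0$ and $\hat w_{k+1}^\circ=\hat w_k^\circ+L(\hat w_k^\circ-\mathbb{E}\{w|I_k\})$. $\overline K$ is the symmetric positive-semidefinite solution of $\overline K=\overline K-\overline K(\overline K+\gamma I)^{-1}\overline K+\overline Q$. (The updating functions $u_k^\circ$ are those solving the problem of minimizing $\liminf_{N\to+\infty}\frac1N\mathbb{E}\{\sum_{k=0}^{N-1}[(e_k'x_k)^2+\gamma u_k'u_k]\}$.) *)

theory Defs
  imports "HOL-Probability.Probability"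
begin

definition pos_semidef :: "real^'n^'n \<Rightarrow> bool" where
  "pos_semidef A \<longleftrightarrow> transpose A = A \<and> (\<forall>v. 0 \<le> v \<bullet> (A *v v))"

definition pos_def :: "real^'n^'n \<Rightarrow> bool" where
  "pos_def A \<longleftrightarrow> transpose A = A \<and> (\<forall>v. v \<noteq> 0 \<longrightarrow> 0 < v \<bullet> (A *v v))"

definition second_moment_matrix :: "'w measure \<Rightarrow> ('w \<Rightarrow> real^'n) \<Rightarrow> real^'n^'n" where
  "second_moment_matrix M X = (\<chi> i j. \<integral>\<omega>. X \<omega> $ i * X \<omega> $ j \<partial>M)"

definition covariance_matrix :: "'w measure \<Rightarrow> ('w \<Rightarrow> real^'n) \<Rightarrow> real^'n^'n" where
  "covariance_matrix M X = second_moment_matrix M (\<lambda>\<omega>. X \<omega> - (\<integral>\<omega>'. X \<omega>' \<partial>M))"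

text \<open>The second alternative is the degenerate normal law. It is needed because linear functionals
  of a Gaussian vector may be constant: always for \<open>a = 0\<close> below, and for other \<open>a\<close> when the
  covariance matrix is singular.\<close>

definition gaussian_variable :: "'w measure \<Rightarrow> ('w \<Rightarrow> real) \<Rightarrow> bool" where
  "gaussian_variable M X \<longleftrightarrow>
     (\<exists>\<mu> \<sigma>. \<sigma> > 0 \<and> distributed M lborel X (normal_density \<mu> \<sigma>)) \<or>
     (X \<in> borel_measurable M \<and> (\<exists>\<mu>. AE \<omega> in M. X \<omega> = \<mu>))"

definition gaussian_vector :: "'w measure \<Rightarrow> ('w \<Rightarrow> real^'n) \<Rightarrow> bool" where
  "gaussian_vector M X \<longleftrightarrow>
     X \<in> borel_measurable M \<and> (\<forall>a. gaussian_variable M (\<lambda>\<omega>. a \<bullet> X \<omega>))"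

definition law_support :: "('a::topological_space) measure \<Rightarrow> 'a set" where
  "law_support D = {z. \<forall>U. open U \<longrightarrow> z \<in> U \<longrightarrow> 0 < emeasure D U}"

definition vec_cond_exp ::
    "'w measure \<Rightarrow> 'w measure \<Rightarrow> ('w \<Rightarrow> real^'n) \<Rightarrow> 'w \<Rightarrow> real^'n" where
  "vec_cond_exp M F X \<omega> = (\<chi> i. real_cond_exp M F (\<lambda>\<omega>'. X \<omega>' $ i) \<omega>)"

datatype source = Parameter | Input nat | Noise nat

text \<open>Since the random variables have values in different spaces, their mutual independence is
  stated for the \<open>\<sigma>\<close>-algebras that they generate, as in the definition of
  \<open>indep_vars\<close>.\<close>

fun source_events ::
    "'w measure \<Rightarrow> ('w \<Rightarrow> real^'n) \<Rightarrow> (nat \<Rightarrow> 'w \<Rightarrow> real^'n) \<Rightarrow> (nat \<Rightarrow> 'w \<Rightarrow> real)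
      \<Rightarrow> source \<Rightarrow> 'w set set" where
  "source_events M w x \<epsilon> Parameter = sets (vimage_algebra (space M) w borel)"
| "source_events M w x \<epsilon> (Input k) = sets (vimage_algebra (space M) (x k) borel)"
| "source_events M w x \<epsilon> (Noise k) = sets (vimage_algebra (space M) (\<epsilon> k) borel)"

locale data_model = prob_space M
  for M :: "'w measure" +
  fixes w :: "'w \<Rightarrow> real^'n"
    and x :: "nat \<Rightarrow> 'w \<Rightarrow> real^'n"
    and \<epsilon> :: "nat \<Rightarrow> 'w \<Rightarrow> real"
    and \<Sigma>w :: "real^'n^'n"
    and \<sigma>\<epsilon> :: real
    and Q :: "real^'n^'n"
  assumes independent: "indep_sets (source_events M w x \<epsilon>) UNIV"
    and w_gaussian: "gaussian_vector M w"
    and w_mean: "expectation w = 0"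
    and w_covariance: "covariance_matrix M w = \<Sigma>w"
    and noise_sd_pos: "\<sigma>\<epsilon> > 0"
    and noise_gaussian: "\<And>k. distributed M lborel (\<epsilon> k) (normal_density 0 \<sigma>\<epsilon>)"
    and x_measurable: "\<And>k. x k \<in> borel_measurable M"
    and x_identically_distributed: "\<And>j k. distr M borel (x j) = distr M borel (x k)"
    and x_bounded_support: "\<And>k. bounded (law_support (distr M borel (x k)))"
    and x_mean: "\<And>k. expectation (x k) = 0"
    and x_second_moment: "\<And>k. second_moment_matrix M (x k) = Q"
    and Q_pos_def: "pos_def Q"

definition outputs ::
    "('w \<Rightarrow> real^'n) \<Rightarrow> (nat \<Rightarrow> 'w \<Rightarrow> real^'n) \<Rightarrow> (nat \<Rightarrow> 'w \<Rightarrow> real) \<Rightarrow> nat \<Rightarrow> 'w \<Rightarrow> real" where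
  "outputs w x \<epsilon> k \<omega> = w \<omega> \<bullet> x k \<omega> + \<epsilon> k \<omega>"

type_synonym 'n info = "(nat \<Rightarrow> (real^'n) \<times> real) \<times> (nat \<Rightarrow> real^'n)"

definition information ::
    "(nat \<Rightarrow> 'w \<Rightarrow> real^'n) \<Rightarrow> (nat \<Rightarrow> 'w \<Rightarrow> real) \<Rightarrow> (nat \<Rightarrow> 'w \<Rightarrow> real^'n) \<Rightarrow> nat \<Rightarrow> 'w \<Rightarrow> 'n info" where
  "information x y u k \<omega> = ((\<lambda>j\<in>{..k}. (x j \<omega>, y j \<omega>)), (\<lambda>j\<in>{..<k}. u j \<omega>))"

definition information_space :: "nat \<Rightarrow> ('n::finite) info measure" where
  "information_space k = (\<Pi>\<^sub>M j\<in>{..k}. borel) \<Otimes>\<^sub>M (\<Pi>\<^sub>M j\<in>{..<k}. borel)"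

definition information_algebra ::
    "'w measure \<Rightarrow> (nat \<Rightarrow> 'w \<Rightarrow> real^'n) \<Rightarrow> (nat \<Rightarrow> 'w \<Rightarrow> real) \<Rightarrow> (nat \<Rightarrow> 'w \<Rightarrow> real^'n)
      \<Rightarrow> nat \<Rightarrow> 'w measure" where
  "information_algebra M x y u k =
     vimage_algebra (space M) (information x y u k) (information_space k)"

definition admissible_updates ::
    "'w measure \<Rightarrow> (nat \<Rightarrow> 'w \<Rightarrow> real^'n) \<Rightarrow> (nat \<Rightarrow> 'w \<Rightarrow> real) \<Rightarrow> (nat \<Rightarrow> 'w \<Rightarrow> real^'n) \<Rightarrow> bool" where
  "admissible_updates M x y u \<longleftrightarrow>
     (\<forall>k. \<exists>f \<in> measurable (information_space k) borel.
        \<forall>\<omega>\<in>space M. u k \<omega> = f (information x y u k \<omega>))"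

primrec estimate :: "(nat \<Rightarrow> 'w \<Rightarrow> real^'n) \<Rightarrow> nat \<Rightarrow> 'w \<Rightarrow> real^'n" where
  "estimate u 0 = (\<lambda>\<omega>. 0)"
| "estimate u (Suc k) = (\<lambda>\<omega>. estimate u k \<omega> + u k \<omega>)"

definition oll_gain :: "real \<Rightarrow> real^'n^'n \<Rightarrow> real^'n^'n" where
  "oll_gain \<gamma> K = - (matrix_inv (K + \<gamma> *\<^sub>R mat 1) ** K)"

text \<open>Conditional expectations are determined only almost everywhere, so this is a predicate:
  each choice of versions gives one sequence of updates.\<close>

definition oll_updates ::
    "'w measure \<Rightarrow> ('w \<Rightarrow> real^'n) \<Rightarrow> (nat \<Rightarrow> 'w \<Rightarrow> real^'n) \<Rightarrow> (nat \<Rightarrow> 'w \<Rightarrow> real)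
      \<Rightarrow> real^'n^'n \<Rightarrow> (nat \<Rightarrow> 'w \<Rightarrow> real^'n) \<Rightarrow> bool" where
  "oll_updates M w x y L u \<longleftrightarrow>
     admissible_updates M x y u \<and>
     (\<forall>k. AE \<omega> in M. u k \<omega> =
        L *v vec_cond_exp M (information_algebra M x y u k) (\<lambda>\<omega>. estimate u k \<omega> - w \<omega>) \<omega>)"

text \<open>Admissible updates need not be square-integrable, so the expected losses are Lebesgue
  integrals with values in \<open>[0, \<infinity>]\<close>. The subtraction in \<open>average_regret\<close> is that of
  \<open>ereal\<close>; its second argument is finite in the data model.\<close>

definition average_loss ::
    "'w measure \<Rightarrow> (nat \<Rightarrow> 'w \<Rightarrow> real^'n) \<Rightarrow> (nat \<Rightarrow> 'w \<Rightarrow> real) \<Rightarrow> (nat \<Rightarrow> 'w \<Rightarrow> real^'n) \<Rightarrow> ereal" where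
  "average_loss M x y v =
     liminf (\<lambda>N. ereal (1 / real N) *
       enn2ereal (\<integral>\<^sup>+\<omega>. ennreal (\<Sum>k<N. (v k \<omega> \<bullet> x k \<omega> - y k \<omega>)\<^sup>2) \<partial>M))"

definition average_regret ::
    "'w measure \<Rightarrow> ('w \<Rightarrow> real^'n) \<Rightarrow> (nat \<Rightarrow> 'w \<Rightarrow> real^'n) \<Rightarrow> (nat \<Rightarrow> 'w \<Rightarrow> real)
      \<Rightarrow> (nat \<Rightarrow> 'w \<Rightarrow> real^'n) \<Rightarrow> ereal" where
  "average_regret M w x y v = average_loss M x y v - average_loss M x y (\<lambda>k. w)"

end

theory Submission
  imports Defs
begin

text \<open>The noise \<open>\<epsilon> k\<close> is independent of the estimate at time \<open>k\<close>, so every expected loss is the sum of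
  \<open>\<sigma>\<epsilon>\<^sup>2\<close> and the mean square of \<open>e\<^sub>k' x\<^sub>k\<close>; hence no admissible sequence has an average loss below
  \<open>\<sigma>\<epsilon>\<^sup>2\<close>. The OLL estimates attain this bound. Their error satisfies
  \<open>e\<^sub>k\<^sub>+\<^sub>1 = (I + L) e\<^sub>k + L (E{e\<^sub>k | I\<^sub>k} - e\<^sub>k)\<close>, and the Riccati equation forces \<open>K\<close> to be regular, so that
  \<open>I + L\<close> is a strict contraction. The perturbation \<open>E{e\<^sub>k | I\<^sub>k} - e\<^sub>k = w - E{w | I\<^sub>k}\<close> is controlled by the
  error of an explicit estimator of \<open>w\<close> from the data, \<open>Q\<^sup>-\<^sup>1\<close> times the mean of the \<open>y\<^sub>j x\<^sub>j\<close>, whose mean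
  square is \<open>O(1/k)\<close> because the deviations \<open>Q w - y\<^sub>j x\<^sub>j\<close> are bounded in mean square and pairwise
  uncorrelated. Thus the mean square of \<open>e\<^sub>k\<close> tends to 0 on average.\<close>

section \<open>Factorization of measurable functions and the support of a law\<close>

text \<open>This is the Doob-Dynkin lemma. Level sets of a simple function are preimages of sets in
  \<open>N\<close>, so simple functions factor through \<open>g\<close>, and limits inherit the
  factorization. It turns measurability with respect to an information algebra into the explicit
  updating function that admissibility asks for.\<close>

lemma vimage_algebra_factorization:
  fixes f :: "'a \<Rightarrow> 'b::{banach, second_countable_topology}"
  assumes g: "g \<in> X \<rightarrow> space N" and f: "f \<in> borel_measurable (vimage_algebra X g N)"
  shows "\<exists>h\<in>borel_measurable N. \<forall>x\<in>X. f x = h (g x)"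
proof -
  obtain F where F: "\<And>i. simple_function (vimage_algebra X g N) (F i)"
    and lim: "\<And>x. x \<in> X \<Longrightarrow> (\<lambda>i. F i x) \<longlonglongrightarrow> f x"
    using borel_measurable_implies_sequence_metric[OF f, of 0] by auto
  have "\<exists>h\<in>borel_measurable N. \<forall>x\<in>X. F i x = h (g x)" for i
  proof -
    have fin: "finite (F i ` X)" using F[of i] by (simp add: simple_function_def)
    have "\<forall>v\<in>F i ` X. \<exists>B\<in>sets N. F i -` {v} \<inter> X = g -` B \<inter> X"
      using F[of i] by (fastforce simp: simple_function_def sets_vimage_algebra2[OF g])
    then obtain B where B: "\<And>v. v \<in> F i ` X \<Longrightarrow> B v \<in> sets N"
      "\<And>v. v \<in> F i ` X \<Longrightarrow> F i -` {v} \<inter> X = g -` B v \<inter> X"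
      by metis
    \<comment> \<open>The sets \<open>B v\<close> may overlap outside the image of \<open>X\<close>
      under \<open>g\<close>; on that image exactly one of them applies, which is all that
      \<open>h\<close> needs.\<close>
    define h where "h z = (\<Sum>v\<in>F i ` X. indicat_real (B v) z *\<^sub>R v)" for z
    have "h \<in> borel_measurable N" unfolding h_def using B(1) by measurable
    moreover have "F i x = h (g x)" if x: "x \<in> X" for x
    proof -
      have "h (g x) = (\<Sum>v\<in>F i ` X. if v = F i x then v else 0)"
        unfolding h_def
      proof (rule sum.cong)
        fix v assume v: "v \<in> F i ` X"
        have "g x \<in> B v \<longleftrightarrow> v = F i x" using B(2)[OF v] x by (auto simp: set_eq_iff)
        then show "indicat_real (B v) (g x) *\<^sub>R v = (if v = F i x then v else 0)" by auto
      qed simp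
      also have "\<dots> = F i x" using x fin by simp
      finally show ?thesis by simp
    qed
    ultimately show ?thesis by blast
  qed
  then obtain h where h: "\<And>i. h i \<in> borel_measurable N" "\<And>i x. x \<in> X \<Longrightarrow> F i x = h i (g x)"
    by metis
  \<comment> \<open>Away from the image of \<open>X\<close> under \<open>g\<close> the sequence
    \<open>h i z\<close> may diverge; \<open>lim\<close> then takes some fixed value, and the limit
    function is still measurable on all of \<open>N\<close>.\<close>
  show ?thesis
  proof (rule bexI[of _ "\<lambda>z. lim (\<lambda>i. h i z)"])
    show "\<forall>x\<in>X. f x = lim (\<lambda>i. h i (g x))"
      using lim by (auto simp: h(2) intro!: limI[symmetric])
  qed (use h(1) in measurable)
qed

text \<open>Every point off the support has a null basic neighbourhood, and a countable basis
  provides only countably many of these, so their union is null.\<close>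

lemma AE_law_support:
  fixes D :: "'a::second_countable_topology measure"
  assumes "sets D = sets borel"
  shows "AE z in D. z \<in> law_support D"
proof -
  obtain B :: "'a set set" where B: "countable B" "topological_basis B"
    using ex_countable_basis by blast
  let ?N = "\<Union>{U \<in> B. emeasure D U = 0}"
  have "?N \<in> null_sets D"
    using B assms by (intro null_sets_UN'[where N=id, simplified])
      (auto intro: countable_subset null_setsI simp: topological_basis_open)
  moreover have "{z \<in> space D. z \<notin> law_support D} \<subseteq> ?N"
  proof
    fix z assume "z \<in> {z \<in> space D. z \<notin> law_support D}"
    then obtain U where U: "open U" "z \<in> U" "emeasure D U = 0"
      by (auto simp: law_support_def not_less)
    obtain V where V: "V \<in> B" "z \<in> V" "V \<subseteq> U"
      using topological_basisE[OF B(2) U(1,2)] by blast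
    have "emeasure D V \<le> emeasure D U"
      using V(3) U(1) assms by (intro emeasure_mono) auto
    then show "z \<in> ?N" using U(3) V by auto
  qed
  ultimately show ?thesis by (rule AE_I')
qed

section \<open>The Riccati equation and the OLL gain\<close>

lemma matrix_inv_inverse:
  fixes A :: "real^'n^'n"
  assumes "invertible A"
  shows "A ** matrix_inv A = mat 1" "matrix_inv A ** A = mat 1"
  using someI_ex[OF assms[unfolded invertible_def]] by (auto simp: matrix_inv_def)

lemma matrix_vector_mult_minus: "(- A) *v v = - (A *v v)"
  for A :: "real^'n^'m"
  by (simp add: matrix_vector_mult_def vec_eq_iff sum_negf)

text \<open>With \<open>T = K + \<gamma> *\<^sub>R mat 1\<close>, which is invertible since
  \<open>K\<close> is semidefinite, the matrix \<open>I + L\<close> equals \<open>\<gamma>\<close>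
  times the inverse of \<open>T\<close>. The Riccati equation reads
  \<open>K ** matrix_inv T ** K = Q\<close>, so the kernel of \<open>K\<close> lies in that of
  \<open>Q\<close> and is trivial; \<open>T\<close> therefore stretches vectors by a factor bounded
  away from \<open>\<gamma>\<close> from above.\<close>

lemma riccati_gain_contraction:
  fixes K Q :: "real^'n^'n"
  assumes gamma: "\<gamma> > 0" and K_psd: "pos_semidef K" and Q: "pos_def Q"
    and riccati: "K = K - K ** matrix_inv (K + \<gamma> *\<^sub>R mat 1) ** K + Q"
  obtains r where "0 \<le> r" "r < 1" "\<And>v. norm (v + oll_gain \<gamma> K *v v) \<le> r * norm v"
proof -
  define T where "T = K + \<gamma> *\<^sub>R mat 1"
  have Tv: "T *v z = K *v z + \<gamma> *\<^sub>R z" for z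
    by (simp add: T_def matrix_vector_mult_add_rdistrib scaleR_matrix_vector_assoc[symmetric])
  have Kpos: "0 \<le> z \<bullet> (K *v z)" for z using K_psd by (simp add: pos_semidef_def)
  have "z = 0" if "T *v z = 0" for z
  proof -
    have "0 = z \<bullet> (T *v z)" using that by simp
    also have "\<dots> = z \<bullet> (K *v z) + \<gamma> * (z \<bullet> z)" by (simp add: Tv inner_add_right)
    finally have "\<gamma> * (z \<bullet> z) \<le> 0" using Kpos[of z] by linarith
    then show "z = 0" using gamma by (simp add: mult_le_0_iff) (metis inner_gt_zero_iff not_less)
  qed
  then have "\<exists>B. B ** T = mat 1" by (simp add: matrix_left_invertible_ker)
  then have "invertible T" by (simp add: invertible_left_inverse)
  then have inv: "T ** matrix_inv T = mat 1" "matrix_inv T ** T = mat 1"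
    by (simp_all add: matrix_inv_inverse)
  have ric: "K ** matrix_inv T ** K = Q"
    using riccati unfolding T_def[symmetric] by (simp add: algebra_simps)
  have "z = 0" if "K *v z = 0" for z
  proof (rule ccontr)
    assume "z \<noteq> 0"
    then have "0 < z \<bullet> (Q *v z)" using Q by (simp add: pos_def_def)
    moreover have "Q *v z = 0" unfolding ric[symmetric] matrix_vector_mul_assoc[symmetric] that by simp
    ultimately show False by simp
  qed
  then have "inj ((*v) K)" by (simp add: linear_injective_0)
  then obtain m where m: "m > 0" "\<And>z. m * norm z \<le> norm (K *v z)"
    using linear_inj_bounded_below_pos[of "(*v) K"] by auto
  \<comment> \<open>The cross term \<open>z \<bullet> (K *v z)\<close> is nonnegative, so
    \<open>norm (K *v z + \<gamma> *\<^sub>R z)\<close> is at least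
    \<open>sqrt (\<gamma>\<^sup>2 + m\<^sup>2) * norm z\<close>; the rate compares
    \<open>\<gamma> * norm z\<close> with this.\<close>
  define r where "r = \<gamma> / sqrt (\<gamma>\<^sup>2 + m\<^sup>2)"
  have s: "\<gamma> < sqrt (\<gamma>\<^sup>2 + m\<^sup>2)" using m(1) gamma by (intro real_less_rsqrt) simp
  have "norm (v + oll_gain \<gamma> K *v v) \<le> r * norm v" for v
  proof -
    define z where "z = matrix_inv T *v v"
    have v: "v = K *v z + \<gamma> *\<^sub>R z" unfolding Tv[symmetric] z_def
      by (simp add: matrix_vector_mul_assoc inv)
    \<comment> \<open>Replacing \<open>K\<close> by \<open>T - \<gamma> I\<close> makes the terms
      without \<open>z\<close> cancel in \<open>v + L v\<close>.\<close>
    have "matrix_inv T *v (K *v v) = matrix_inv T *v (T *v v - \<gamma> *\<^sub>R v)" by (simp add: Tv)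
    also have "\<dots> = v - \<gamma> *\<^sub>R z"
      by (simp add: matrix_vector_mult_diff_distrib matrix_vector_mul_assoc inv z_def matrix_vector_mult_scaleR)
    finally have g: "v + oll_gain \<gamma> K *v v = \<gamma> *\<^sub>R z"
      by (simp add: oll_gain_def T_def[symmetric] matrix_vector_mult_minus matrix_vector_mul_assoc[symmetric])
    have "(\<gamma>\<^sup>2 + m\<^sup>2) * (norm z)\<^sup>2 \<le> (norm v)\<^sup>2"
    proof -
      have "(norm v)\<^sup>2 = (norm (K *v z))\<^sup>2 + 2 * \<gamma> * (z \<bullet> (K *v z)) + \<gamma>\<^sup>2 * (norm z)\<^sup>2"
        unfolding v power2_norm_eq_inner
        by (simp add: inner_simps inner_commute power2_eq_square algebra_simps)
      moreover have "(m * norm z)\<^sup>2 \<le> (norm (K *v z))\<^sup>2"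
        using m by (intro power_mono) auto
      moreover have "0 \<le> 2 * \<gamma> * (z \<bullet> (K *v z))" using Kpos[of z] gamma by simp
      ultimately show ?thesis by (simp add: algebra_simps power_mult_distrib)
    qed
    then have "sqrt ((\<gamma>\<^sup>2 + m\<^sup>2) * (norm z)\<^sup>2) \<le> norm v"
      by (intro real_le_lsqrt) auto
    then have "sqrt (\<gamma>\<^sup>2 + m\<^sup>2) * norm z \<le> norm v" by (simp add: real_sqrt_mult)
    then have "norm z \<le> norm v / sqrt (\<gamma>\<^sup>2 + m\<^sup>2)"
      using s gamma by (subst pos_le_divide_eq) (auto simp: mult.commute add_pos_nonneg)
    then show ?thesis unfolding g r_def using gamma by (simp add: mult_left_mono flip: times_divide_eq_right)
  qed
  moreover have "0 \<le> r" "r < 1"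
    unfolding r_def using s gamma less_trans[OF gamma s] by (auto simp del: real_sqrt_gt_0_iff)
  ultimately show ?thesis using that by blast
qed

section \<open>Averages of sequences under a contracting recursion\<close>

text \<open>The difference \<open>harm n - ln n\<close> converges to the Euler-Mascheroni constant,
  and both it and \<open>ln n\<close> are negligible against \<open>n\<close>.\<close>

lemma harm_average_tendsto_0: "(\<lambda>n. harm n / real n) \<longlonglongrightarrow> (0::real)"
proof -
  have "(\<lambda>n. (harm n - ln (of_nat n)) / real n + ln (real n) / real n) \<longlonglongrightarrow> 0 + 0"
    by (intro tendsto_add lim_ln_over_n tendsto_divide_0[OF euler_mascheroni_LIMSEQ]
        filterlim_at_top_imp_at_infinity filterlim_real_sequentially)
  then show ?thesis by (simp add: diff_divide_distrib)
qed

text \<open>Summing the recursion lets the sum of the \<open>a k\<close> absorb \<open>r\<close>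
  times itself and leaves \<open>a 0\<close> plus \<open>C\<close> times a harmonic number. No rate
  for the single \<open>a k\<close> is needed, as the regret only sees averages.\<close>

lemma contraction_average_tendsto_0:
  fixes a :: "nat \<Rightarrow> real"
  assumes r: "0 \<le> r" "r < 1" and nonneg: "\<And>k. 0 \<le> a k"
    and step: "\<And>k. a (Suc k) \<le> r * a k + C / real (Suc k)"
  shows "(\<lambda>n. (\<Sum>k<n. a k) / real n) \<longlonglongrightarrow> 0"
proof -
  have bound: "(1 - r) * (\<Sum>k<n. a k) \<le> a 0 + C * harm n" for n
  proof -
    have "(\<Sum>k<n. a k) \<le> (\<Sum>k<Suc n. a k)" using nonneg by simp
    also have "\<dots> = a 0 + (\<Sum>k<n. a (Suc k))" by (rule sum.lessThan_Suc_shift)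
    also have "\<dots> \<le> a 0 + (\<Sum>k<n. r * a k + C / real (Suc k))"
      by (intro add_left_mono sum_mono step)
    also have "\<dots> = a 0 + r * (\<Sum>k<n. a k) + C * harm n"
      by (simp add: harm_altdef sum.distrib sum_distrib_left divide_inverse)
    finally show ?thesis by (simp add: algebra_simps)
  qed
  have "(\<lambda>n. (a 0 / real n + C * (harm n / real n)) / (1 - r)) \<longlonglongrightarrow> (0 + C * 0) / (1 - r)"
    by (intro tendsto_intros harm_average_tendsto_0 lim_const_over_n) (use r in auto)
  then have lim: "(\<lambda>n. (a 0 / real n + C * (harm n / real n)) / (1 - r)) \<longlonglongrightarrow> 0" by simp
  show ?thesis
  proof (rule tendsto_sandwich[OF _ _ tendsto_const lim])
    show "\<forall>\<^sub>F n in sequentially. 0 \<le> (\<Sum>k<n. a k) / real n"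
      by (intro always_eventually allI divide_nonneg_nonneg sum_nonneg nonneg) auto
    show "\<forall>\<^sub>F n in sequentially. (\<Sum>k<n. a k) / real n \<le> (a 0 / real n + C * (harm n / real n)) / (1 - r)"
    proof (intro always_eventually allI)
      fix n
      have "(\<Sum>k<n. a k) \<le> (a 0 + C * harm n) / (1 - r)"
        using bound[of n] r by (simp add: pos_le_divide_eq mult.commute)
      then have "(\<Sum>k<n. a k) / real n \<le> (a 0 + C * harm n) / (1 - r) / real n"
        by (rule divide_right_mono) simp
      then show "(\<Sum>k<n. a k) / real n \<le> (a 0 / real n + C * (harm n / real n)) / (1 - r)"
        by (simp add: add_divide_distrib mult.commute)
    qed
  qed
qed

section \<open>Square-integrable random variables and vectors\<close>

definition square_integrable :: "'a measure \<Rightarrow> ('a \<Rightarrow> 'b::euclidean_space) \<Rightarrow> bool" where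
  "square_integrable M f \<longleftrightarrow> f \<in> borel_measurable M \<and> integrable M (\<lambda>\<omega>. (norm (f \<omega>))\<^sup>2)"

lemma square_integrable_measurable: "square_integrable M f \<Longrightarrow> f \<in> borel_measurable M"
  by (simp add: square_integrable_def)

lemma square_integrable_zero [simp]: "square_integrable M (\<lambda>_. 0)"
  by (simp add: square_integrable_def)

lemma norm_add_power2_le: "(norm (a + b))\<^sup>2 \<le> 2 * (norm a)\<^sup>2 + 2 * (norm b)\<^sup>2"
proof -
  have "(norm (a + b))\<^sup>2 \<le> (norm a + norm b)\<^sup>2"
    by (intro power_mono norm_triangle_ineq) auto
  also have "\<dots> \<le> 2 * (norm a)\<^sup>2 + 2 * (norm b)\<^sup>2"
    using sum_squares_bound[of "norm a" "norm b"] by (simp add: power2_sum)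
  finally show ?thesis .
qed

text \<open>The bound is required only almost everywhere, since the inputs are bounded, and the OLL
  updates prescribed, only up to null sets.\<close>

lemma square_integrable_dominated:
  assumes f: "f \<in> borel_measurable M" and g: "square_integrable M g"
    and bound: "AE \<omega> in M. norm (f \<omega>) \<le> C * norm (g \<omega>)"
  shows "square_integrable M f"
proof -
  have "integrable M (\<lambda>\<omega>. (norm (f \<omega>))\<^sup>2)"
  proof (rule Bochner_Integration.integrable_bound)
    show "integrable M (\<lambda>\<omega>. C\<^sup>2 * (norm (g \<omega>))\<^sup>2)" using g by (simp add: square_integrable_def)
    show "AE \<omega> in M. norm ((norm (f \<omega>))\<^sup>2) \<le> norm (C\<^sup>2 * (norm (g \<omega>))\<^sup>2)"
      using bound
    proof eventually_elim
      case (elim \<omega>)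
      then have "(norm (f \<omega>))\<^sup>2 \<le> (C * norm (g \<omega>))\<^sup>2" by (intro power_mono) auto
      then show ?case by (simp add: power_mult_distrib)
    qed
  qed (use f in measurable)
  with f show ?thesis by (simp add: square_integrable_def)
qed

lemma square_integrable_add:
  assumes "square_integrable M f" "square_integrable M g"
  shows "square_integrable M (\<lambda>\<omega>. f \<omega> + g \<omega>)"
proof -
  have [measurable]: "f \<in> borel_measurable M" "g \<in> borel_measurable M"
    using assms by (auto simp: square_integrable_def)
  have "integrable M (\<lambda>\<omega>. (norm (f \<omega> + g \<omega>))\<^sup>2)"
  proof (rule Bochner_Integration.integrable_bound)
    show "integrable M (\<lambda>\<omega>. 2 * (norm (f \<omega>))\<^sup>2 + 2 * (norm (g \<omega>))\<^sup>2)"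
      using assms by (simp add: square_integrable_def)
    show "AE \<omega> in M. norm ((norm (f \<omega> + g \<omega>))\<^sup>2) \<le> norm (2 * (norm (f \<omega>))\<^sup>2 + 2 * (norm (g \<omega>))\<^sup>2)"
      by (intro always_eventually allI) (simp add: norm_add_power2_le)
  qed measurable
  then show ?thesis by (simp add: square_integrable_def)
qed

lemma square_integrable_bounded_linear:
  assumes T: "bounded_linear T" and f: "square_integrable M f"
  shows "square_integrable M (\<lambda>\<omega>. T (f \<omega>))"
proof -
  obtain C where "\<And>x. norm (T x) \<le> norm x * C" using bounded_linear.bounded[OF T] by blast
  moreover have "(\<lambda>\<omega>. T (f \<omega>)) \<in> borel_measurable M"
    by (rule measurable_compose[OF square_integrable_measurable[OF f] borel_measurable_continuous_onI])
      (intro linear_continuous_on T)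
  ultimately show ?thesis
    by (intro square_integrable_dominated[OF _ f, of _ C]) (auto simp: mult.commute)
qed

lemma square_integrable_minus:
  assumes "square_integrable M f" shows "square_integrable M (\<lambda>\<omega>. - f \<omega>)"
  using square_integrable_bounded_linear[OF bounded_linear_minus[OF bounded_linear_ident] assms] .

lemma square_integrable_diff:
  assumes "square_integrable M f" "square_integrable M g"
  shows "square_integrable M (\<lambda>\<omega>. f \<omega> - g \<omega>)"
  using square_integrable_add[OF assms(1) square_integrable_minus[OF assms(2)]] by simp

lemma square_integrable_sum:
  assumes "\<And>i. i \<in> I \<Longrightarrow> square_integrable M (f i)"
  shows "square_integrable M (\<lambda>\<omega>. \<Sum>i\<in>I. f i \<omega>)"
  using assms by (induction I rule: infinite_finite_induct) (auto intro: square_integrable_add)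

lemma square_integrable_component:
  assumes "square_integrable M f" shows "square_integrable M (\<lambda>\<omega>. f \<omega> $ i)"
  by (rule square_integrable_bounded_linear[OF bounded_linear_vec_nth assms])

lemma norm_power2_eq_sum: "(norm v)\<^sup>2 = (\<Sum>i\<in>UNIV. (v $ i)\<^sup>2)" for v :: "real^'n"
  by (simp add: norm_vec_def L2_set_def sum_nonneg)

lemma component_measurable:
  "f \<in> borel_measurable N \<Longrightarrow> (\<lambda>\<omega>. f \<omega> $ i) \<in> borel_measurable N" for f :: "_ \<Rightarrow> real^'m"
  by (rule measurable_compose[OF _ borel_measurable_continuous_onI]) (auto intro: continuous_intros)

lemma borel_measurable_vecI:
  fixes f :: "'a \<Rightarrow> real^'n"
  assumes "\<And>i. (\<lambda>\<omega>. f \<omega> $ i) \<in> borel_measurable M"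
  shows "f \<in> borel_measurable M"
  unfolding borel_measurable_euclidean_space[where f=f]
  using assms by (auto simp: Basis_vec_def inner_axis)

lemma square_integrable_vecI:
  fixes f :: "'a \<Rightarrow> real^'n"
  assumes "\<And>i. square_integrable M (\<lambda>\<omega>. f \<omega> $ i)"
  shows "square_integrable M f"
proof -
  have "f \<in> borel_measurable M"
    using assms by (intro borel_measurable_vecI) (simp add: square_integrable_def)
  then show ?thesis
    using assms by (auto simp: square_integrable_def norm_power2_eq_sum)
qed

lemma integrable_mult_square_integrable:
  fixes f g :: "'a \<Rightarrow> real"
  assumes "square_integrable M f" "square_integrable M g"
  shows "integrable M (\<lambda>\<omega>. f \<omega> * g \<omega>)"
proof (rule Bochner_Integration.integrable_bound)
  show "integrable M (\<lambda>\<omega>. (f \<omega>)\<^sup>2 + (g \<omega>)\<^sup>2)"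
    using assms by (simp add: square_integrable_def)
  show "AE \<omega> in M. norm (f \<omega> * g \<omega>) \<le> norm ((f \<omega>)\<^sup>2 + (g \<omega>)\<^sup>2)"
  proof (intro always_eventually allI)
    fix \<omega>
    have "2 * (\<bar>f \<omega>\<bar> * \<bar>g \<omega>\<bar>) \<le> (f \<omega>)\<^sup>2 + (g \<omega>)\<^sup>2"
      using sum_squares_bound[of "\<bar>f \<omega>\<bar>" "\<bar>g \<omega>\<bar>"] by simp
    then show "norm (f \<omega> * g \<omega>) \<le> norm ((f \<omega>)\<^sup>2 + (g \<omega>)\<^sup>2)"
      by (simp add: abs_mult) (smt (verit) mult_nonneg_nonneg abs_ge_zero)
  qed
qed (use assms in \<open>auto simp: square_integrable_def\<close>)

lemma (in finite_measure) integrable_square_integrable: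
  fixes f :: "'a \<Rightarrow> real"
  assumes "square_integrable M f" shows "integrable M f"
  using integrable_mult_square_integrable[OF assms, of "\<lambda>_. 1"] by (simp add: square_integrable_def)

section \<open>Conditional expectation in mean square\<close>

context finite_measure_subalgebra
begin

text \<open>The conditional Jensen inequality for the square gives a pointwise bound; integrating it
  removes the conditioning.\<close>

lemma square_integrable_real_cond_exp:
  assumes f: "square_integrable M f"
  shows "square_integrable M (real_cond_exp M F f)"
    and "(\<integral>\<omega>. (real_cond_exp M F f \<omega>)\<^sup>2 \<partial>M) \<le> (\<integral>\<omega>. (f \<omega>)\<^sup>2 \<partial>M)"
proof -
  have f1: "integrable M f" by (rule integrable_square_integrable[OF f])
  have f2: "integrable M (\<lambda>\<omega>. (f \<omega>)\<^sup>2)" using f by (simp add: square_integrable_def)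
  have jensen: "AE \<omega> in M. (real_cond_exp M F f \<omega>)\<^sup>2 \<le> real_cond_exp M F (\<lambda>\<omega>. (f \<omega>)\<^sup>2) \<omega>"
    by (rule real_cond_exp_jensens_inequality[OF f1, of UNIV, where q="\<lambda>x. x\<^sup>2"])
      (auto intro: f2 convex_power2)
  have int: "integrable M (real_cond_exp M F (\<lambda>\<omega>. (f \<omega>)\<^sup>2))"
    and eq: "(\<integral>\<omega>. real_cond_exp M F (\<lambda>\<omega>. (f \<omega>)\<^sup>2) \<omega> \<partial>M) = (\<integral>\<omega>. (f \<omega>)\<^sup>2 \<partial>M)"
    using real_cond_exp_int[OF f2] by auto
  have sq: "integrable M (\<lambda>\<omega>. (real_cond_exp M F f \<omega>)\<^sup>2)"
    by (rule Bochner_Integration.integrable_bound[OF int]) (use jensen in auto)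
  then show "square_integrable M (real_cond_exp M F f)" by (simp add: square_integrable_def)
  show "(\<integral>\<omega>. (real_cond_exp M F f \<omega>)\<^sup>2 \<partial>M) \<le> (\<integral>\<omega>. (f \<omega>)\<^sup>2 \<partial>M)"
    unfolding eq[symmetric] by (rule integral_mono_AE[OF sq int jensen])
qed

text \<open>The constant 4 is not optimal (1 is), but it is all that Jensen's inequality gives without
  the projection property.\<close>

lemma real_cond_exp_error:
  assumes f: "square_integrable M f" and g: "square_integrable M g" and gF: "g \<in> borel_measurable F"
  shows "(\<integral>\<omega>. (real_cond_exp M F f \<omega> - f \<omega>)\<^sup>2 \<partial>M) \<le> 4 * (\<integral>\<omega>. (f \<omega> - g \<omega>)\<^sup>2 \<partial>M)"
proof -
  \<comment> \<open>As \<open>g\<close> is \<open>F\<close>-measurable, it is its own conditional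
    expectation; subtracting it from \<open>f\<close> leaves the error of conditioning
    unchanged.\<close>
  define D where "D \<omega> = f \<omega> - g \<omega>" for \<omega>
  have D: "square_integrable M D" unfolding D_def by (rule square_integrable_diff[OF f g])
  note CD = square_integrable_real_cond_exp[OF D]
  have "AE \<omega> in M. real_cond_exp M F D \<omega> = real_cond_exp M F f \<omega> - real_cond_exp M F g \<omega>"
    unfolding D_def by (intro real_cond_exp_diff integrable_square_integrable f g)
  moreover have "AE \<omega> in M. real_cond_exp M F g \<omega> = g \<omega>"
    by (intro real_cond_exp_F_meas integrable_square_integrable g gF)
  ultimately have err: "AE \<omega> in M. (real_cond_exp M F f \<omega> - f \<omega>)\<^sup>2 = (real_cond_exp M F D \<omega> - D \<omega>)\<^sup>2"
    by eventually_elim (simp add: D_def)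
  have [measurable]: "f \<in> borel_measurable M" "D \<in> borel_measurable M"
    using f D by (auto simp: square_integrable_def)
  have "(\<integral>\<omega>. (real_cond_exp M F f \<omega> - f \<omega>)\<^sup>2 \<partial>M) = (\<integral>\<omega>. (real_cond_exp M F D \<omega> - D \<omega>)\<^sup>2 \<partial>M)"
    by (rule integral_cong_AE[OF _ _ err]) auto
  also have "\<dots> \<le> (\<integral>\<omega>. 2 * (real_cond_exp M F D \<omega>)\<^sup>2 + 2 * (D \<omega>)\<^sup>2 \<partial>M)"
  proof (rule integral_mono)
    show "integrable M (\<lambda>\<omega>. (real_cond_exp M F D \<omega> - D \<omega>)\<^sup>2)"
      using square_integrable_diff[OF CD(1) D] by (simp add: square_integrable_def)
    show "integrable M (\<lambda>\<omega>. 2 * (real_cond_exp M F D \<omega>)\<^sup>2 + 2 * (D \<omega>)\<^sup>2)"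
      using CD(1) D by (simp add: square_integrable_def)
    show "(real_cond_exp M F D \<omega> - D \<omega>)\<^sup>2 \<le> 2 * (real_cond_exp M F D \<omega>)\<^sup>2 + 2 * (D \<omega>)\<^sup>2" for \<omega>
      using norm_add_power2_le[of "real_cond_exp M F D \<omega>" "- D \<omega>"] by simp
  qed
  also have "\<dots> = 2 * (\<integral>\<omega>. (real_cond_exp M F D \<omega>)\<^sup>2 \<partial>M) + 2 * (\<integral>\<omega>. (D \<omega>)\<^sup>2 \<partial>M)"
    using CD(1) D by (simp add: square_integrable_def)
  also have "\<dots> \<le> 4 * (\<integral>\<omega>. (D \<omega>)\<^sup>2 \<partial>M)" using CD(2) by simp
  finally show ?thesis by (simp add: D_def)
qed

end

section \<open>Estimates of squares under contraction, independence and Gaussian laws\<close>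

text \<open>This is convexity of the square at \<open>r * s + (1 - r) * t\<close>. The factor of
  \<open>s\<^sup>2\<close> stays \<open>r\<close>, hence below 1, as the recursion for mean squares
  needs; the price is the division of the other term by \<open>1 - r\<close>.\<close>

lemma norm_add_contraction_power2:
  fixes a b :: "'a::real_normed_vector"
  assumes r: "0 \<le> r" "r < 1" and a: "norm a \<le> r * s" and s: "0 \<le> s"
  shows "(norm (a + b))\<^sup>2 \<le> r * s\<^sup>2 + (norm b)\<^sup>2 / (1 - r)"
proof -
  define t where "t = norm b / (1 - r)"
  have t: "norm b = (1 - r) * t" using r by (simp add: t_def)
  have "(norm (a + b))\<^sup>2 \<le> (r * s + (1 - r) * t)\<^sup>2"
    using norm_triangle_ineq[of a b] a t by (intro power_mono) auto
  also have "\<dots> = r * s\<^sup>2 + (1 - r) * t\<^sup>2 - r * (1 - r) * (s - t)\<^sup>2"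
    by (simp add: power2_eq_square algebra_simps)
  also have "\<dots> \<le> r * s\<^sup>2 + (1 - r) * t\<^sup>2" using r by simp
  also have "(1 - r) * t\<^sup>2 = (norm b)\<^sup>2 / (1 - r)" using r by (simp add: t power2_eq_square)
  finally show ?thesis .
qed

text \<open>Independence gives a product law; integrating over \<open>Y\<close> first, its zero mean
  removes the cross term. Nonnegative integrals are used because \<open>X\<close> need not be
  square-integrable, as with the errors of arbitrary admissible updates.\<close>

lemma (in prob_space) nn_integral_diff_indep_power2:
  fixes X Y :: "'a \<Rightarrow> real"
  assumes indep: "indep_var borel X borel Y"
    and Y: "square_integrable M Y" and mean: "expectation Y = 0"
  shows "(\<integral>\<^sup>+\<omega>. ennreal ((X \<omega> - Y \<omega>)\<^sup>2) \<partial>M)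
    = (\<integral>\<^sup>+\<omega>. ennreal ((X \<omega>)\<^sup>2) \<partial>M) + ennreal (expectation (\<lambda>\<omega>. (Y \<omega>)\<^sup>2))"
proof -
  have [measurable]: "X \<in> borel_measurable M" "Y \<in> borel_measurable M"
    using indep by (auto dest: indep_var_rv1 indep_var_rv2)
  interpret Y: prob_space "distr M borel Y" by (rule prob_space_distr) simp
  have iY: "integrable M Y" "integrable M (\<lambda>\<omega>. (Y \<omega>)\<^sup>2)"
    using Y integrable_square_integrable[OF Y] by (auto simp: square_integrable_def)
  have inner: "(\<integral>\<^sup>+\<omega>. ennreal ((a - Y \<omega>)\<^sup>2) \<partial>M) = ennreal (a\<^sup>2) + ennreal (expectation (\<lambda>\<omega>. (Y \<omega>)\<^sup>2))" for a
  proof -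
    have "integrable M (\<lambda>\<omega>. (a - Y \<omega>)\<^sup>2)" using iY by (simp add: power2_diff)
    then have "(\<integral>\<^sup>+\<omega>. ennreal ((a - Y \<omega>)\<^sup>2) \<partial>M) = ennreal (\<integral>\<omega>. (a - Y \<omega>)\<^sup>2 \<partial>M)"
      by (intro nn_integral_eq_integral always_eventually allI zero_le_power2)
    also have "(\<integral>\<omega>. (a - Y \<omega>)\<^sup>2 \<partial>M) = a\<^sup>2 + expectation (\<lambda>\<omega>. (Y \<omega>)\<^sup>2)"
      using iY mean by (simp add: power2_diff prob_space)
    finally show ?thesis by (simp add: ennreal_plus integral_nonneg)
  qed
  have "(\<integral>\<^sup>+\<omega>. ennreal ((X \<omega> - Y \<omega>)\<^sup>2) \<partial>M)
    = (\<integral>\<^sup>+z. ennreal ((fst z - snd z)\<^sup>2) \<partial>distr M (borel \<Otimes>\<^sub>M borel) (\<lambda>\<omega>. (X \<omega>, Y \<omega>)))"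
    by (subst nn_integral_distr) auto
  also have "distr M (borel \<Otimes>\<^sub>M borel) (\<lambda>\<omega>. (X \<omega>, Y \<omega>)) = distr M borel X \<Otimes>\<^sub>M distr M borel Y"
    using indep by (simp add: indep_var_distribution_eq)
  also have "(\<integral>\<^sup>+z. ennreal ((fst z - snd z)\<^sup>2) \<partial>(distr M borel X \<Otimes>\<^sub>M distr M borel Y))
    = (\<integral>\<^sup>+a. \<integral>\<^sup>+b. ennreal ((a - b)\<^sup>2) \<partial>distr M borel Y \<partial>distr M borel X)"
    by (subst Y.nn_integral_fst[symmetric]) auto
  also have "\<dots> = (\<integral>\<^sup>+\<omega>. \<integral>\<^sup>+\<omega>'. ennreal ((X \<omega> - Y \<omega>')\<^sup>2) \<partial>M \<partial>M)"
    by (simp add: nn_integral_distr)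
  also have "\<dots> = (\<integral>\<^sup>+\<omega>. ennreal ((X \<omega>)\<^sup>2) \<partial>M) + ennreal (expectation (\<lambda>\<omega>. (Y \<omega>)\<^sup>2))"
    by (simp add: inner nn_integral_add emeasure_space_1)
  finally show ?thesis .
qed

lemma (in prob_space) gaussian_variable_square_integrable:
  assumes "gaussian_variable M X" shows "square_integrable M X"
  using assms unfolding gaussian_variable_def
proof
  assume "\<exists>\<mu> \<sigma>. \<sigma> > 0 \<and> distributed M lborel X (normal_density \<mu> \<sigma>)"
  then obtain \<mu> \<sigma> where \<sigma>: "\<sigma> > 0" and D: "distributed M lborel X (normal_density \<mu> \<sigma>)" by blast
  have X: "X \<in> borel_measurable M" using distributed_measurable[OF D] by simp
  have "expectation (\<lambda>\<omega>. (X \<omega> - \<mu>)\<^sup>2) = \<sigma>\<^sup>2"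
    using normal_distributed_variance[OF \<sigma> D] normal_distributed_expectation[OF \<sigma> D] by simp
  \<comment> \<open>The integral of a non-integrable function is 0 by convention, so the positive
    value \<open>\<sigma>\<^sup>2\<close> proves integrability.\<close>
  then have "integrable M (\<lambda>\<omega>. (X \<omega> - \<mu>)\<^sup>2)"
    using \<sigma> by (metis not_integrable_integral_eq power_not_zero less_irrefl)
  then have "square_integrable M (\<lambda>\<omega>. X \<omega> - \<mu>)" using X by (simp add: square_integrable_def)
  from square_integrable_add[OF this, of "\<lambda>_. \<mu>"] show ?thesis by (simp add: square_integrable_def)
next
  assume "X \<in> borel_measurable M \<and> (\<exists>\<mu>. AE \<omega> in M. X \<omega> = \<mu>)"
  then obtain \<mu> where X: "X \<in> borel_measurable M" and ae: "AE \<omega> in M. X \<omega> = \<mu>" by blast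
  show ?thesis
    by (rule square_integrable_dominated[OF X, of "\<lambda>_. \<mu>" 1])
      (use ae in \<open>auto simp: square_integrable_def\<close>)
qed

section \<open>Information, admissible updates and the existence of OLL updates\<close>

lemma space_information_space: "information x y u k \<omega> \<in> space (information_space k)"
  by (auto simp: information_def information_space_def space_pair_measure space_PiM)

lemma measurable_information:
  assumes "\<And>j. j \<le> k \<Longrightarrow> x j \<in> borel_measurable G" "\<And>j. j \<le> k \<Longrightarrow> y j \<in> borel_measurable G"
    and "\<And>j. j < k \<Longrightarrow> u j \<in> borel_measurable G"
  shows "information x y u k \<in> measurable G (information_space k)"
  unfolding information_def information_space_def
  by (intro measurable_Pair measurable_restrict borel_measurable_Pair) (use assms in auto)

lemma measurable_information_algebra:
  "information x y u k \<in> measurable (information_algebra M x y u k) (information_space k)"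
  unfolding information_algebra_def
  by (rule measurable_vimage_algebra1) (simp add: space_information_space)

lemma measurable_information_components:
  shows "j \<le> k \<Longrightarrow> x j \<in> borel_measurable (information_algebra M x y u k)"
    and "j \<le> k \<Longrightarrow> y j \<in> borel_measurable (information_algebra M x y u k)"
    and "j < k \<Longrightarrow> u j \<in> borel_measurable (information_algebra M x y u k)"
proof -
  note info = measurable_information_algebra[of x y u k M, unfolded information_space_def]
  have 1: "(\<lambda>\<omega>. fst (information x y u k \<omega>) j) \<in> borel_measurable (information_algebra M x y u k)"
    if "j \<le> k"
    by (rule measurable_compose[OF measurable_compose[OF info measurable_fst]
      measurable_component_singleton]) (use that in simp)
  have 2: "(\<lambda>\<omega>. snd (information x y u k \<omega>) j) \<in> borel_measurable (information_algebra M x y u k)"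
    if "j < k"
    by (rule measurable_compose[OF measurable_compose[OF info measurable_snd]
      measurable_component_singleton]) (use that in simp)
  show "j \<le> k \<Longrightarrow> x j \<in> borel_measurable (information_algebra M x y u k)"
    using measurable_compose[OF 1 borel_measurable_continuous_onI, of fst]
    by (simp add: information_def continuous_on_fst)
  show "j \<le> k \<Longrightarrow> y j \<in> borel_measurable (information_algebra M x y u k)"
    using measurable_compose[OF 1 borel_measurable_continuous_onI, of snd]
    by (simp add: information_def continuous_on_snd)
  show "j < k \<Longrightarrow> u j \<in> borel_measurable (information_algebra M x y u k)"
    using 2 by (simp add: information_def)
qed

lemma measurable_estimate:
  assumes "\<And>j. j < k \<Longrightarrow> u j \<in> borel_measurable G"
  shows "estimate u k \<in> borel_measurable G"
  using assms by (induction k) auto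

text \<open>The information at time \<open>k\<close> contains earlier updates, which by strong
  induction are functions of the data alone. The algebra \<open>G\<close> is left open so that the
  lemma serves both for \<open>M\<close> and for the algebra of all sources except one
  noise.\<close>

lemma measurable_admissible_updates:
  assumes "admissible_updates M x y u" and "space G = space M"
    and "\<And>j. j \<le> k \<Longrightarrow> x j \<in> borel_measurable G" "\<And>j. j \<le> k \<Longrightarrow> y j \<in> borel_measurable G"
  shows "u k \<in> borel_measurable G"
  using assms(3,4)
proof (induction k rule: less_induct)
  case (less k)
  obtain f where f: "f \<in> measurable (information_space k) borel"
    and u: "\<forall>\<omega>\<in>space M. u k \<omega> = f (information x y u k \<omega>)"
    using assms(1) by (auto simp: admissible_updates_def)
  have "information x y u k \<in> measurable G (information_space k)"
    using less by (intro measurable_information) auto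
  then have "(\<lambda>\<omega>. f (information x y u k \<omega>)) \<in> borel_measurable G"
    using f by (rule measurable_compose)
  then show ?case using u assms(2) by (subst measurable_cong) auto
qed

lemma estimate_cong: "(\<And>j. j < k \<Longrightarrow> u j = v j) \<Longrightarrow> estimate u k = estimate v k"
  by (induction k) auto

lemma information_cong: "(\<And>j. j < k \<Longrightarrow> u j = v j) \<Longrightarrow> information x y u k = information x y v k"
  by (auto simp: information_def fun_eq_iff restrict_def)

text \<open>The conditional expectation behind update \<open>k\<close> refers to the algebra
  generated by the earlier updates, so the sequence is built by recursion. Factorization through the
  information then supplies the updating functions.\<close>

lemma ex_oll_updates:
  fixes w :: "'w \<Rightarrow> real^'n" and x :: "nat \<Rightarrow> 'w \<Rightarrow> real^'n"
  shows "\<exists>u. oll_updates M w x y L u"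
proof -
  define step where "step k u =
    (\<lambda>\<omega>. L *v vec_cond_exp M (information_algebra M x y u k) (\<lambda>\<omega>. estimate u k \<omega> - w \<omega>) \<omega>)"
    for k and u :: "nat \<Rightarrow> 'w \<Rightarrow> real^'n"
  \<comment> \<open>The recursion carries a whole sequence: the entries of \<open>U k\<close> below
    \<open>k\<close> are final, the others are 0, and passing to \<open>Suc k\<close> fills entry
    \<open>k\<close>.\<close>
  define U where "U = rec_nat (\<lambda>_ _. 0) (\<lambda>k u. u(k := step k u))"
  define u where "u k = U (Suc k) k" for k
  have U_Suc: "U (Suc k) = (U k)(k := step k (U k))" for k by (simp add: U_def)
  have U_u: "j < m \<Longrightarrow> U m j = u j" for j m
    by (induction m) (auto simp: U_Suc u_def less_Suc_eq)
  have u_step: "u k = step k u" for k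
  proof -
    \<comment> \<open>\<open>step k\<close> reads its argument only at times below \<open>k\<close>,
      where \<open>U k\<close> and \<open>u\<close> agree.\<close>
    have "estimate (U k) k = estimate u k" "information x y (U k) k = information x y u k"
      by (intro estimate_cong information_cong U_u; assumption)+
    then show ?thesis by (simp add: u_def U_Suc step_def information_algebra_def)
  qed
  have "\<exists>f\<in>measurable (information_space k) borel. \<forall>\<omega>\<in>space M. u k \<omega> = f (information x y u k \<omega>)" for k
  proof -
    let ?F = "information_algebra M x y u k"
    have "(\<lambda>\<omega>. vec_cond_exp M ?F (\<lambda>\<omega>. estimate u k \<omega> - w \<omega>) \<omega>) \<in> borel_measurable ?F"
      by (rule borel_measurable_vecI) (simp add: vec_cond_exp_def)
    then have "u k \<in> borel_measurable ?F"
      unfolding u_step[of k] step_def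
      by (rule measurable_compose)
        (intro borel_measurable_continuous_onI linear_continuous_on matrix_vector_mul_bounded_linear)
    then show ?thesis
      unfolding information_algebra_def
      by (intro vimage_algebra_factorization) (auto simp: space_information_space)
  qed
  then have "oll_updates M w x y L u"
    using u_step by (auto simp: oll_updates_def admissible_updates_def step_def fun_eq_iff)
  then show ?thesis by (rule exI[of _ u])
qed

section \<open>Independence of the sources\<close>

context data_model
begin

text \<open>Independence of two random variables reduces to naming disjoint sets of sources that
  determine them.\<close>

definition source_algebra :: "source set \<Rightarrow> 'w measure" where
  "source_algebra S = sigma (space M) (\<Union>i\<in>S. source_events M w x \<epsilon> i)"

lemma w_measurable: "w \<in> borel_measurable M"
  using w_gaussian by (simp add: gaussian_vector_def)

lemma noise_measurable: "\<epsilon> k \<in> borel_measurable M"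
  using distributed_measurable[OF noise_gaussian[of k]] by simp

lemma source_events_subset: "source_events M w x \<epsilon> i \<subseteq> Pow (space M)"
  by (cases i) (auto dest!: sets.sets_into_space[of _ "vimage_algebra _ _ _"])

lemma space_source_algebra [simp]: "space (source_algebra S) = space M"
  unfolding source_algebra_def using source_events_subset by (intro space_measure_of) blast

lemma sets_source_algebra:
  "sets (source_algebra S) = sigma_sets (space M) (\<Union>i\<in>S. source_events M w x \<epsilon> i)"
  unfolding source_algebra_def using source_events_subset by (intro sets_measure_of) blast

lemma source_algebra_measurable:
  shows "Parameter \<in> S \<Longrightarrow> w \<in> borel_measurable (source_algebra S)"
    and "Input k \<in> S \<Longrightarrow> x k \<in> borel_measurable (source_algebra S)"
    and "Noise k \<in> S \<Longrightarrow> \<epsilon> k \<in> borel_measurable (source_algebra S)"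
proof -
  have aux: "f \<in> borel_measurable (source_algebra S)"
    if "i \<in> S" "source_events M w x \<epsilon> i = sets (vimage_algebra (space M) f borel)"
    for i and f :: "'w \<Rightarrow> 'b::topological_space"
  proof (rule measurableI)
    fix A :: "'b set" assume "A \<in> sets borel"
    then have "f -` A \<inter> space M \<in> source_events M w x \<epsilon> i"
      unfolding that by (rule in_vimage_algebra)
    then show "f -` A \<inter> space (source_algebra S) \<in> sets (source_algebra S)"
      using that(1) by (auto simp: sets_source_algebra)
  qed simp
  show "Parameter \<in> S \<Longrightarrow> w \<in> borel_measurable (source_algebra S)"
    by (rule aux[of Parameter]) auto
  show "Input k \<in> S \<Longrightarrow> x k \<in> borel_measurable (source_algebra S)"
    by (rule aux[of "Input k"]) auto
  show "Noise k \<in> S \<Longrightarrow> \<epsilon> k \<in> borel_measurable (source_algebra S)"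
    by (rule aux[of "Noise k"]) auto
qed

lemma sets_source_algebra_subset: "sets (source_algebra S) \<subseteq> events"
proof -
  have "source_events M w x \<epsilon> i \<subseteq> events" for i
    using independent by (auto simp: indep_sets_def)
  then show ?thesis unfolding sets_source_algebra by (intro sets.sigma_sets_subset) blast
qed

text \<open>The events of one source are closed under intersection, so independence passes to the
  algebras generated by disjoint blocks of sources, and from there to the smaller algebras of
  \<open>X\<close> and \<open>Y\<close>.\<close>

lemma source_algebra_indep_var:
  assumes disj: "S \<inter> T = {}"
    and X: "X \<in> borel_measurable (source_algebra S)" and Y: "Y \<in> borel_measurable (source_algebra T)"
  shows "indep_var borel X borel Y"
proof -
  let ?I = "case_bool S T"
  have "indep_sets (\<lambda>j. sigma_sets (space M) (\<Union>i\<in>?I j. source_events M w x \<epsilon> i)) UNIV"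
  proof (rule indep_sets_collect_sigma)
    show "indep_sets (source_events M w x \<epsilon>) (\<Union>j\<in>UNIV. ?I j)"
      by (rule indep_sets_mono_index[OF _ independent]) simp
    show "Int_stable (source_events M w x \<epsilon> i)" for i
      by (cases i) (auto simp: Int_stable_def)
    show "disjoint_family_on ?I UNIV"
      using disj by (auto simp: disjoint_family_on_def split: bool.splits)
  qed
  then have "indep_sets (case_bool (sets (source_algebra S)) (sets (source_algebra T))) UNIV"
    by (rule indep_sets_mono_sets) (auto simp: sets_source_algebra split: bool.splits)
  then have st: "indep_set (sets (source_algebra S)) (sets (source_algebra T))"
    by (simp add: indep_set_def)
  have sub: "sigma_sets (space M) {Z -` A \<inter> space M |A. A \<in> sets borel} \<subseteq> sets (source_algebra V)"
    if "Z \<in> borel_measurable (source_algebra V)" for V and Z :: "'w \<Rightarrow> 'b::topological_space"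
  proof -
    have "{Z -` A \<inter> space M |A. A \<in> sets borel} \<subseteq> sets (source_algebra V)"
      using measurable_sets[OF that] by auto
    from sets.sigma_sets_subset[OF this] show ?thesis by simp
  qed
  have "X \<in> borel_measurable M" "Y \<in> borel_measurable M"
    using X Y sets_source_algebra_subset by (auto simp: measurable_def)
  moreover have "indep_set (sigma_sets (space M) {X -` A \<inter> space M |A. A \<in> sets borel})
    (sigma_sets (space M) {Y -` A \<inter> space M |A. A \<in> sets borel})"
    using st sub[OF X] sub[OF Y] unfolding indep_sets2_eq by blast
  ultimately show ?thesis by (simp add: indep_var_eq)
qed

section \<open>Moments and bounds for noises, parameter, inputs and outputs\<close>

lemma noise_moments:
  shows "square_integrable M (\<epsilon> k)" "expectation (\<epsilon> k) = 0" "expectation (\<lambda>\<omega>. (\<epsilon> k \<omega>)\<^sup>2) = \<sigma>\<epsilon>\<^sup>2"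
proof -
  show m: "expectation (\<epsilon> k) = 0"
    by (rule normal_distributed_expectation[OF noise_sd_pos noise_gaussian])
  show v: "expectation (\<lambda>\<omega>. (\<epsilon> k \<omega>)\<^sup>2) = \<sigma>\<epsilon>\<^sup>2"
    using normal_distributed_variance[OF noise_sd_pos noise_gaussian[of k]] m by simp
  \<comment> \<open>Again a nonzero integral rules out the default value 0 of non-integrable
    functions.\<close>
  then have "integrable M (\<lambda>\<omega>. (\<epsilon> k \<omega>)\<^sup>2)"
    using noise_sd_pos by (metis not_integrable_integral_eq power_not_zero less_irrefl)
  then show "square_integrable M (\<epsilon> k)" by (simp add: square_integrable_def noise_measurable)
qed

lemma parameter_square_integrable: "square_integrable M w"
proof (rule square_integrable_vecI)
  fix i
  have "gaussian_variable M (\<lambda>\<omega>. axis i 1 \<bullet> w \<omega>)"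
    using w_gaussian by (simp add: gaussian_vector_def)
  then show "square_integrable M (\<lambda>\<omega>. w \<omega> $ i)"
    using gaussian_variable_square_integrable by (simp add: inner_axis' )
qed

text \<open>A law gives full measure to its support, which is bounded here; one \<open>B\<close>
  serves all times because the inputs share one law.\<close>

lemma input_bounded:
  obtains B where "0 \<le> B" "\<And>k. AE \<omega> in M. norm (x k \<omega>) \<le> B"
proof -
  obtain B where B: "\<And>z. z \<in> law_support (distr M borel (x 0)) \<Longrightarrow> norm z \<le> B"
    using x_bounded_support[of 0] by (auto simp: bounded_iff)
  have "AE \<omega> in M. norm (x k \<omega>) \<le> max B 0" for k
  proof -
    have "AE z in distr M borel (x k). z \<in> law_support (distr M borel (x k))"
      by (rule AE_law_support) simp
    then have "AE z in distr M borel (x k). norm z \<le> max B 0"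
      by eventually_elim (use B x_identically_distributed[of k 0] in force)
    then show ?thesis
      using x_measurable[of k] by (subst (asm) AE_distr_iff) auto
  qed
  then show ?thesis using that[of "max B 0"] by simp
qed


abbreviation y :: "nat \<Rightarrow> 'w \<Rightarrow> real" where "y \<equiv> outputs w x \<epsilon>"

lemma outputs_measurable:
  assumes "Parameter \<in> S" "Input k \<in> S" "Noise k \<in> S"
  shows "y k \<in> borel_measurable (source_algebra S)"
  unfolding outputs_def[abs_def]
  using assms by (intro borel_measurable_add borel_measurable_inner source_algebra_measurable)

lemma borel_measurable_source_algebra:
  "f \<in> borel_measurable (source_algebra S) \<Longrightarrow> f \<in> borel_measurable M"
  using sets_source_algebra_subset by (auto simp: measurable_def)

lemma outputs_borel_measurable: "y k \<in> borel_measurable M"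
  by (rule borel_measurable_source_algebra[OF outputs_measurable[of UNIV]]) auto

lemma outputs_square_integrable: "square_integrable M (y k)"
proof -
  obtain B where B: "0 \<le> B" "\<And>k. AE \<omega> in M. norm (x k \<omega>) \<le> B" using input_bounded by blast
  have "square_integrable M (\<lambda>\<omega>. w \<omega> \<bullet> x k \<omega>)"
  proof (rule square_integrable_dominated[OF _ parameter_square_integrable])
    show "(\<lambda>\<omega>. w \<omega> \<bullet> x k \<omega>) \<in> borel_measurable M"
      using w_measurable x_measurable by measurable
    show "AE \<omega> in M. norm (w \<omega> \<bullet> x k \<omega>) \<le> B * norm (w \<omega>)"
      using B(2)[of k]
    proof eventually_elim
      case (elim \<omega>)
      have "norm (w \<omega> \<bullet> x k \<omega>) \<le> norm (w \<omega>) * norm (x k \<omega>)" by (simp add: Cauchy_Schwarz_ineq2)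
      also have "\<dots> \<le> norm (w \<omega>) * B" using elim by (intro mult_left_mono) auto
      finally show ?case by (simp add: mult.commute)
    qed
  qed
  then show ?thesis unfolding outputs_def[abs_def] using noise_moments(1) by (rule square_integrable_add)
qed

lemma outputs_scale_input_square_integrable: "square_integrable M (\<lambda>\<omega>. y k \<omega> *\<^sub>R x k \<omega>)"
proof -
  obtain B where B: "0 \<le> B" "\<And>k. AE \<omega> in M. norm (x k \<omega>) \<le> B" using input_bounded by blast
  show ?thesis
  proof (rule square_integrable_dominated[OF _ outputs_square_integrable])
    show "(\<lambda>\<omega>. y k \<omega> *\<^sub>R x k \<omega>) \<in> borel_measurable M"
      using outputs_borel_measurable x_measurable by measurable
    show "AE \<omega> in M. norm (y k \<omega> *\<^sub>R x k \<omega>) \<le> B * norm (y k \<omega>)"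
      using B(2)[of k] by eventually_elim (simp add: mult.commute mult_right_mono)
  qed
qed

section \<open>Deviations and the moment estimator\<close>

text \<open>Given \<open>w\<close>, the vector \<open>y k *\<^sub>R x k\<close> has mean
  \<open>Q *v w\<close>, because the noise is centred and independent of the input. The deviations
  are its fluctuations about that mean, with the sign reversed.\<close>

definition deviation :: "nat \<Rightarrow> 'w \<Rightarrow> real^'n" where
  "deviation k \<omega> = Q *v w \<omega> - y k \<omega> *\<^sub>R x k \<omega>"

lemma deviation_square_integrable: "square_integrable M (deviation k)"
  unfolding deviation_def[abs_def]
  by (intro square_integrable_diff outputs_scale_input_square_integrable
      square_integrable_bounded_linear[OF matrix_vector_mul_bounded_linear parameter_square_integrable])

text \<open>Every summand is displayed with a centred factor that depends on one source: the entry
  of \<open>Q\<close> minus the input product, or the noise. Orthogonality rests on this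
  form.\<close>

lemma deviation_component:
  "deviation k \<omega> $ i = (\<Sum>l\<in>UNIV. (Q $ i $ l - x k \<omega> $ l * x k \<omega> $ i) * w \<omega> $ l) - \<epsilon> k \<omega> * x k \<omega> $ i"
  by (simp add: deviation_def outputs_def matrix_vector_mult_def inner_vec_def algebra_simps
      sum_subtractf sum_distrib_left)

lemma deviation_second_moment_bound:
  obtains C where "\<And>k. expectation (\<lambda>\<omega>. (norm (deviation k \<omega>))\<^sup>2) \<le> C"
proof -
  obtain B where B: "0 \<le> B" "\<And>k. AE \<omega> in M. norm (x k \<omega>) \<le> B" using input_bounded by blast
  obtain q where q: "0 \<le> q" "\<And>v. norm (Q *v v) \<le> norm v * q"
    using bounded_linear.nonneg_bounded[OF matrix_vector_mul_bounded_linear[of Q]] by blast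
  \<comment> \<open>Per unit norm of \<open>w\<close>, \<open>q\<close> bounds \<open>Q *v w\<close>
    and \<open>B * B\<close> bounds \<open>(w \<bullet> x k) *\<^sub>R x k\<close>.\<close>
  define b where "b = q + B * B"
  have "expectation (\<lambda>\<omega>. (norm (deviation k \<omega>))\<^sup>2)
    \<le> 2 * b\<^sup>2 * expectation (\<lambda>\<omega>. (norm (w \<omega>))\<^sup>2) + 2 * B\<^sup>2 * \<sigma>\<epsilon>\<^sup>2" for k
  proof -
    have bound: "AE \<omega> in M. (norm (deviation k \<omega>))\<^sup>2 \<le> 2 * b\<^sup>2 * (norm (w \<omega>))\<^sup>2 + 2 * B\<^sup>2 * (\<epsilon> k \<omega>)\<^sup>2"
      using B(2)[of k]
    proof eventually_elim
      case (elim \<omega>)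
      have "\<bar>w \<omega> \<bullet> x k \<omega>\<bar> \<le> norm (w \<omega>) * B"
        using Cauchy_Schwarz_ineq2[of "w \<omega>" "x k \<omega>"] elim
        by (meson mult_left_mono norm_ge_zero order_trans)
      then have "\<bar>y k \<omega>\<bar> * norm (x k \<omega>) \<le> (norm (w \<omega>) * B + \<bar>\<epsilon> k \<omega>\<bar>) * B"
        using elim B(1) by (intro mult_mono) (auto simp: outputs_def)
      moreover have "norm (deviation k \<omega>) \<le> norm (Q *v w \<omega>) + \<bar>y k \<omega>\<bar> * norm (x k \<omega>)"
        unfolding deviation_def by (metis norm_triangle_ineq4 norm_scaleR)
      ultimately have "norm (deviation k \<omega>) \<le> b * norm (w \<omega>) + B * \<bar>\<epsilon> k \<omega>\<bar>"
        using q(2)[of "w \<omega>"] by (simp add: b_def algebra_simps)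
      then have "(norm (deviation k \<omega>))\<^sup>2 \<le> (norm (b * norm (w \<omega>) + B * \<bar>\<epsilon> k \<omega>\<bar>))\<^sup>2"
        by (intro power_mono) auto
      also have "\<dots> \<le> 2 * (norm (b * norm (w \<omega>)))\<^sup>2 + 2 * (norm (B * \<bar>\<epsilon> k \<omega>\<bar>))\<^sup>2"
        by (rule norm_add_power2_le)
      finally show ?case by (simp add: power_mult_distrib)
    qed
    have int: "integrable M (\<lambda>\<omega>. (norm (w \<omega>))\<^sup>2)" "integrable M (\<lambda>\<omega>. (\<epsilon> k \<omega>)\<^sup>2)"
      using parameter_square_integrable noise_moments(1)[of k] by (auto simp: square_integrable_def)
    have "expectation (\<lambda>\<omega>. (norm (deviation k \<omega>))\<^sup>2)
      \<le> expectation (\<lambda>\<omega>. 2 * b\<^sup>2 * (norm (w \<omega>))\<^sup>2 + 2 * B\<^sup>2 * (\<epsilon> k \<omega>)\<^sup>2)"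
      using deviation_square_integrable[of k] int
      by (intro integral_mono_AE bound) (auto simp: square_integrable_def)
    also have "\<dots> = 2 * b\<^sup>2 * expectation (\<lambda>\<omega>. (norm (w \<omega>))\<^sup>2) + 2 * B\<^sup>2 * \<sigma>\<epsilon>\<^sup>2"
      using int by (simp add: noise_moments)
    finally show ?thesis .
  qed
  then show ?thesis using that by blast
qed

text \<open>The two factors depend on complementary sets of sources, so the expectation of the
  product splits and the centred factor annihilates it.\<close>

lemma expectation_mult_zero:
  fixes X Y :: "'w \<Rightarrow> real"
  assumes "X \<in> borel_measurable (source_algebra S)" "Y \<in> borel_measurable (source_algebra (- S))"
    and "square_integrable M X" "integrable M Y" "expectation X = 0"
  shows "integrable M (\<lambda>\<omega>. X \<omega> * Y \<omega>) \<and> expectation (\<lambda>\<omega>. X \<omega> * Y \<omega>) = 0"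
proof -
  have "indep_var borel X borel Y"
    by (rule source_algebra_indep_var[OF _ assms(1,2)]) simp
  note * = indep_var_integrable[OF this] indep_var_lebesgue_integral[OF this]
  show ?thesis
    using * assms(3-5) integrable_square_integrable by auto
qed

lemma deviation_measurable:
  assumes "Parameter \<in> S" "Input k \<in> S" "Noise k \<in> S"
  shows "deviation k \<in> borel_measurable (source_algebra S)"
  unfolding deviation_def[abs_def]
  using outputs_measurable[OF assms] source_algebra_measurable assms
  by (intro borel_measurable_diff borel_measurable_scaleR
      measurable_compose[OF _ borel_measurable_continuous_onI[OF
        linear_continuous_on[OF matrix_vector_mul_bounded_linear]]]) auto

lemma input_product_square_integrable: "square_integrable M (\<lambda>\<omega>. Q $ i $ l - x k \<omega> $ l * x k \<omega> $ i)"
proof -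
  obtain B where B: "0 \<le> B" "\<And>k. AE \<omega> in M. norm (x k \<omega>) \<le> B" using input_bounded by blast
  have const: "square_integrable M (\<lambda>_. c)" for c :: real by (simp add: square_integrable_def)
  have "square_integrable M (\<lambda>\<omega>. x k \<omega> $ l * x k \<omega> $ i)"
  proof (rule square_integrable_dominated[OF _ const[of 1], of _ "B * B"])
    show "(\<lambda>\<omega>. x k \<omega> $ l * x k \<omega> $ i) \<in> borel_measurable M"
      by (intro borel_measurable_times component_measurable x_measurable)
    show "AE \<omega> in M. norm (x k \<omega> $ l * x k \<omega> $ i) \<le> B * B * norm (1::real)"
      using B(2)[of k]
    proof eventually_elim
      case (elim \<omega>)
      have "\<bar>x k \<omega> $ j\<bar> \<le> B" for j using component_le_norm_cart[of "x k \<omega>" j] elim by simp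
      then show ?case using B(1) by (auto simp: abs_mult intro: mult_mono)
    qed
  qed
  with const show ?thesis by (rule square_integrable_diff)
qed

lemma input_product_mean: "expectation (\<lambda>\<omega>. Q $ i $ l - x k \<omega> $ l * x k \<omega> $ i) = 0"
proof -
  have "expectation (\<lambda>\<omega>. x k \<omega> $ l * x k \<omega> $ i) = Q $ i $ l"
    using x_second_moment[of k, symmetric] by (simp add: second_moment_matrix_def mult.commute)
  \<comment> \<open>The product is the constant minus the difference already known to be
    integrable.\<close>
  moreover have "integrable M (\<lambda>\<omega>. x k \<omega> $ l * x k \<omega> $ i)"
    using Bochner_Integration.integrable_diff[OF integrable_const
        integrable_square_integrable[OF input_product_square_integrable], of "Q $ i $ l" i l k]
    by simp
  ultimately show ?thesis by (simp add: prob_space)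
qed

lemma deviation_orthogonal:
  assumes "j \<noteq> m"
  shows "expectation (\<lambda>\<omega>. deviation j \<omega> $ i * deviation m \<omega> $ i) = 0"
proof -
  have dev: "square_integrable M (\<lambda>\<omega>. deviation m \<omega> $ i)"
    by (intro square_integrable_component deviation_square_integrable)
  have dev_meas: "(\<lambda>\<omega>. deviation m \<omega> $ i) \<in> borel_measurable (source_algebra S)"
    if "Parameter \<in> S" "Input m \<in> S" "Noise m \<in> S" for S
    by (intro component_measurable deviation_measurable that)
  define X where "X l \<omega> = (Q $ i $ l - x j \<omega> $ l * x j \<omega> $ i) * (w \<omega> $ l * deviation m \<omega> $ i)" for l \<omega>
  define Y where "Y \<omega> = \<epsilon> j \<omega> * (x j \<omega> $ i * deviation m \<omega> $ i)" for \<omega>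
  have X: "integrable M (X l) \<and> expectation (X l) = 0" for l
    unfolding X_def[abs_def]
  proof (rule expectation_mult_zero[of _ "{Input j}"])
    show "(\<lambda>\<omega>. Q $ i $ l - x j \<omega> $ l * x j \<omega> $ i) \<in> borel_measurable (source_algebra {Input j})"
      by (intro borel_measurable_diff borel_measurable_times component_measurable
        source_algebra_measurable) auto
    show "(\<lambda>\<omega>. w \<omega> $ l * deviation m \<omega> $ i) \<in> borel_measurable (source_algebra (- {Input j}))"
      using assms by (intro borel_measurable_times dev_meas component_measurable
        source_algebra_measurable) auto
    show "integrable M (\<lambda>\<omega>. w \<omega> $ l * deviation m \<omega> $ i)"
      by (intro integrable_mult_square_integrable dev square_integrable_component
        parameter_square_integrable)
  qed (rule input_product_square_integrable input_product_mean)+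
  \<comment> \<open>Only noise \<open>j\<close> is split off here; \<open>x j\<close> joins the
    other factor, where its almost sure bound keeps the product square-integrable.\<close>
  have Y: "integrable M Y \<and> expectation Y = 0"
    unfolding Y_def[abs_def]
  proof (rule expectation_mult_zero[of _ "{Noise j}"])
    show "\<epsilon> j \<in> borel_measurable (source_algebra {Noise j})"
      by (intro source_algebra_measurable) auto
    show "(\<lambda>\<omega>. x j \<omega> $ i * deviation m \<omega> $ i) \<in> borel_measurable (source_algebra (- {Noise j}))"
      using assms by (intro borel_measurable_times dev_meas component_measurable
        source_algebra_measurable) auto
    obtain B where B: "0 \<le> B" "\<And>k. AE \<omega> in M. norm (x k \<omega>) \<le> B" using input_bounded by blast
    have "square_integrable M (\<lambda>\<omega>. x j \<omega> $ i * deviation m \<omega> $ i)"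
    proof (rule square_integrable_dominated[OF _ dev])
      show "(\<lambda>\<omega>. x j \<omega> $ i * deviation m \<omega> $ i) \<in> borel_measurable M"
        by (intro borel_measurable_times component_measurable x_measurable
          square_integrable_measurable[OF deviation_square_integrable])
      show "AE \<omega> in M. norm (x j \<omega> $ i * deviation m \<omega> $ i) \<le> B * norm (deviation m \<omega> $ i)"
        using B(2)[of j]
      proof eventually_elim
        case (elim \<omega>)
        have "\<bar>x j \<omega> $ i\<bar> \<le> B" using component_le_norm_cart[of "x j \<omega>" i] elim by simp
        then show ?case by (simp add: abs_mult mult_right_mono)
      qed
    qed
    then show "integrable M (\<lambda>\<omega>. x j \<omega> $ i * deviation m \<omega> $ i)"
      by (rule integrable_square_integrable)
  qed (rule noise_moments)+
  have "(\<lambda>\<omega>. deviation j \<omega> $ i * deviation m \<omega> $ i) = (\<lambda>\<omega>. (\<Sum>l\<in>UNIV. X l \<omega>) - Y \<omega>)"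
    by (simp add: deviation_component[of j] X_def Y_def fun_eq_iff left_diff_distrib sum_distrib_right
      mult.assoc)
  then show ?thesis using X Y by (simp add: Bochner_Integration.integral_sum)
qed

text \<open>This is the Pythagorean identity, coordinate by coordinate: orthogonality removes the
  off-diagonal terms of the double sum.\<close>

lemma deviation_sum_second_moment:
  "expectation (\<lambda>\<omega>. (norm (\<Sum>j<n. deviation j \<omega>))\<^sup>2) = (\<Sum>j<n. expectation (\<lambda>\<omega>. (norm (deviation j \<omega>))\<^sup>2))"
proof -
  have int: "integrable M (\<lambda>\<omega>. deviation j \<omega> $ i * deviation m \<omega> $ i)" for i j m
    by (intro integrable_mult_square_integrable square_integrable_component deviation_square_integrable)
  have "expectation (\<lambda>\<omega>. (norm (\<Sum>j<n. deviation j \<omega>))\<^sup>2)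
    = expectation (\<lambda>\<omega>. \<Sum>i\<in>UNIV. \<Sum>j<n. \<Sum>m<n. deviation j \<omega> $ i * deviation m \<omega> $ i)"
    unfolding norm_power2_eq_sum by (simp add: power2_eq_square sum_product)
  also have "\<dots> = (\<Sum>i\<in>UNIV. \<Sum>j<n. \<Sum>m<n. expectation (\<lambda>\<omega>. deviation j \<omega> $ i * deviation m \<omega> $ i))"
    using int by (simp add: Bochner_Integration.integral_sum)
  also have "\<dots> = (\<Sum>i\<in>UNIV. \<Sum>j<n. \<Sum>m<n. if m = j then expectation (\<lambda>\<omega>. (deviation j \<omega> $ i)\<^sup>2) else 0)"
    by (intro sum.cong refl) (auto simp: deviation_orthogonal power2_eq_square)
  also have "\<dots> = (\<Sum>j<n. \<Sum>i\<in>UNIV. expectation (\<lambda>\<omega>. (deviation j \<omega> $ i)\<^sup>2))"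
    by (subst sum.swap) simp
  also have "\<dots> = (\<Sum>j<n. expectation (\<lambda>\<omega>. (norm (deviation j \<omega>))\<^sup>2))"
    unfolding norm_power2_eq_sum using int by (simp add: Bochner_Integration.integral_sum power2_eq_square)
  finally show ?thesis .
qed

text \<open>The method of moments: it solves \<open>Q *v v = s\<close> with \<open>s\<close> the
  sample mean of the \<open>y j *\<^sub>R x j\<close>. With the known \<open>Q\<close> in place of
  the empirical matrix of least squares, no random matrix has to be inverted.\<close>

definition moment_estimator :: "nat \<Rightarrow> 'w \<Rightarrow> real^'n" where
  "moment_estimator n \<omega> = matrix_inv Q *v ((1 / real n) *\<^sub>R (\<Sum>j<n. y j \<omega> *\<^sub>R x j \<omega>))"

lemma Q_invertible: "invertible Q"
proof -
  have "v = 0" if "Q *v v = 0" for v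
    using Q_pos_def that by (force simp: pos_def_def)
  then show ?thesis by (simp add: invertible_left_inverse matrix_left_invertible_ker)
qed

lemma moment_estimator_error:
  assumes "n > 0"
  shows "w \<omega> - moment_estimator n \<omega> = matrix_inv Q *v ((1 / real n) *\<^sub>R (\<Sum>j<n. deviation j \<omega>))"
proof -
  have "(1 / real n) *\<^sub>R (\<Sum>j<n. deviation j \<omega>) = Q *v w \<omega> - (1 / real n) *\<^sub>R (\<Sum>j<n. y j \<omega> *\<^sub>R x j \<omega>)"
    using assms by (simp add: deviation_def sum_subtractf scaleR_right_diff_distrib sum_constant_scaleR
      del: sum_constant)
  then show ?thesis
    using matrix_inv_inverse[OF Q_invertible]
    by (simp add: moment_estimator_def matrix_vector_mult_diff_distrib matrix_vector_mul_assoc)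
qed

lemma moment_estimator_square_integrable: "square_integrable M (moment_estimator n)"
  unfolding moment_estimator_def[abs_def]
  by (intro square_integrable_bounded_linear[OF matrix_vector_mul_bounded_linear]
    square_integrable_bounded_linear[OF bounded_linear_scaleR_right] square_integrable_sum
    outputs_scale_input_square_integrable)

text \<open>By orthogonality the sum of \<open>n\<close> deviations has mean square at most
  \<open>n\<close> times a constant; the averaging factor \<open>1 / n\<close> enters
  squared.\<close>

lemma moment_estimator_error_bound:
  obtains C where "\<And>n. n > 0 \<Longrightarrow> expectation (\<lambda>\<omega>. (norm (w \<omega> - moment_estimator n \<omega>))\<^sup>2) \<le> C / real n"
proof -
  obtain C where C: "\<And>k. expectation (\<lambda>\<omega>. (norm (deviation k \<omega>))\<^sup>2) \<le> C"
    using deviation_second_moment_bound by blast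
  obtain q where q: "0 \<le> q" "\<And>v. norm (matrix_inv Q *v v) \<le> norm v * q"
    using bounded_linear.nonneg_bounded[OF matrix_vector_mul_bounded_linear[of "matrix_inv Q"]] by blast
  have "expectation (\<lambda>\<omega>. (norm (w \<omega> - moment_estimator n \<omega>))\<^sup>2) \<le> q\<^sup>2 * C / real n" if n: "n > 0" for n
  proof -
    have int: "integrable M (\<lambda>\<omega>. (norm (\<Sum>j<n. deviation j \<omega>))\<^sup>2)"
      using square_integrable_sum[where I="{..<n}" and f=deviation, OF deviation_square_integrable]
      by (simp add: square_integrable_def)
    have "expectation (\<lambda>\<omega>. (norm (w \<omega> - moment_estimator n \<omega>))\<^sup>2)
      \<le> expectation (\<lambda>\<omega>. (q / real n)\<^sup>2 * (norm (\<Sum>j<n. deviation j \<omega>))\<^sup>2)"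
    proof (rule integral_mono)
      show "integrable M (\<lambda>\<omega>. (norm (w \<omega> - moment_estimator n \<omega>))\<^sup>2)"
        using square_integrable_diff[OF parameter_square_integrable moment_estimator_square_integrable]
        by (simp add: square_integrable_def)
      show "integrable M (\<lambda>\<omega>. (q / real n)\<^sup>2 * (norm (\<Sum>j<n. deviation j \<omega>))\<^sup>2)" using int by simp
      fix \<omega>
      have "norm (w \<omega> - moment_estimator n \<omega>) \<le> q / real n * norm (\<Sum>j<n. deviation j \<omega>)"
        using q(2)[of "(1 / real n) *\<^sub>R (\<Sum>j<n. deviation j \<omega>)"]
        by (simp add: moment_estimator_error[OF n] mult.commute)
      then show "(norm (w \<omega> - moment_estimator n \<omega>))\<^sup>2 \<le> (q / real n)\<^sup>2 * (norm (\<Sum>j<n. deviation j \<omega>))\<^sup>2"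
        unfolding power_mult_distrib[symmetric] by (intro power_mono) auto
    qed
    also have "\<dots> = (q / real n)\<^sup>2 * (\<Sum>j<n. expectation (\<lambda>\<omega>. (norm (deviation j \<omega>))\<^sup>2))"
      by (simp add: deviation_sum_second_moment)
    also have "\<dots> \<le> (q / real n)\<^sup>2 * (real n * C)"
      using sum_mono[of "{..<n}", OF C] by (intro mult_left_mono) auto
    also have "\<dots> = q\<^sup>2 * C / real n" using n by (simp add: power2_eq_square field_simps)
    finally show ?thesis .
  qed
  then show ?thesis using that by blast
qed

section \<open>Expected losses and their lower bound\<close>

lemma information_algebra_subalgebra:
  assumes "admissible_updates M x y u"
  shows "subalgebra M (information_algebra M x y u k)"
proof -
  have "information x y u k \<in> measurable M (information_space k)"
    by (intro measurable_information measurable_admissible_updates[OF assms] refl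
        x_measurable outputs_borel_measurable)
  then show ?thesis
    by (auto simp: subalgebra_def information_algebra_def intro: sets_image_in_sets[THEN subsetD])
qed

lemma estimate_borel_measurable:
  assumes "admissible_updates M x y u"
  shows "estimate u k \<in> borel_measurable M"
  by (intro measurable_estimate measurable_admissible_updates[OF assms] refl
      x_measurable outputs_borel_measurable)

definition loss :: "(nat \<Rightarrow> 'w \<Rightarrow> real^'n) \<Rightarrow> nat \<Rightarrow> ennreal" where
  "loss u k = (\<integral>\<^sup>+\<omega>. ennreal ((estimate u k \<omega> \<bullet> x k \<omega> - y k \<omega>)\<^sup>2) \<partial>M)"

text \<open>The estimate \<open>estimate u k\<close> depends on the data up to time \<open>k - 1\<close> only, hence not on the
  noise \<open>\<epsilon> k\<close>.\<close>

lemma loss_eq: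
  assumes u: "admissible_updates M x y u"
  shows "loss u k = (\<integral>\<^sup>+\<omega>. ennreal (((estimate u k \<omega> - w \<omega>) \<bullet> x k \<omega>)\<^sup>2) \<partial>M) + ennreal (\<sigma>\<epsilon>\<^sup>2)"
proof -
  let ?G = "source_algebra (- {Noise k})"
  have "estimate u k \<in> borel_measurable ?G"
    by (intro measurable_estimate measurable_admissible_updates[OF u] source_algebra_measurable
        outputs_measurable) auto
  then have "(\<lambda>\<omega>. (estimate u k \<omega> - w \<omega>) \<bullet> x k \<omega>) \<in> borel_measurable ?G"
    by (intro borel_measurable_inner borel_measurable_diff source_algebra_measurable) auto
  moreover have "\<epsilon> k \<in> borel_measurable (source_algebra {Noise k})"
    by (intro source_algebra_measurable) auto
  ultimately have "indep_var borel (\<lambda>\<omega>. (estimate u k \<omega> - w \<omega>) \<bullet> x k \<omega>) borel (\<epsilon> k)"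
    by (intro source_algebra_indep_var[of "- {Noise k}" "{Noise k}"]) auto
  from nn_integral_diff_indep_power2[OF this noise_moments(1,2)] show ?thesis
    by (simp add: loss_def noise_moments(3) outputs_def inner_diff_left algebra_simps)
qed

lemma sum_loss:
  assumes "admissible_updates M x y u"
  shows "(\<integral>\<^sup>+\<omega>. ennreal (\<Sum>k<N. (estimate u k \<omega> \<bullet> x k \<omega> - y k \<omega>)\<^sup>2) \<partial>M) = (\<Sum>k<N. loss u k)"
proof -
  have [measurable]: "estimate u k \<in> borel_measurable M" "x k \<in> borel_measurable M"
    "y k \<in> borel_measurable M" for k
    using estimate_borel_measurable[OF assms] x_measurable outputs_borel_measurable by auto
  show ?thesis by (simp add: loss_def sum_ennreal[symmetric] nn_integral_sum del: sum_ennreal)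
qed

text \<open>Each single loss is at least the noise variance, because the other term of its
  decomposition is nonnegative.\<close>

lemma average_loss_ge:
  assumes u: "admissible_updates M x y u"
  shows "ereal (\<sigma>\<epsilon>\<^sup>2) \<le> average_loss M x y (estimate u)"
  unfolding average_loss_def sum_loss[OF u]
proof (rule Liminf_bounded)
  \<comment> \<open>For \<open>N = 0\<close> the average is 0 and the bound fails, so that case is
    discarded.\<close>
  show "\<forall>\<^sub>F N in sequentially. ereal (\<sigma>\<epsilon>\<^sup>2) \<le> ereal (1 / real N) * enn2ereal (\<Sum>k<N. loss u k)"
    using eventually_gt_at_top[of 0]
  proof eventually_elim
    case (elim N)
    have "ennreal (real N * \<sigma>\<epsilon>\<^sup>2) = (\<Sum>k<N. ennreal (\<sigma>\<epsilon>\<^sup>2))"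
      by (subst sum_ennreal) auto
    also have "\<dots> \<le> (\<Sum>k<N. loss u k)" by (intro sum_mono) (simp add: loss_eq[OF u])
    finally have "enn2ereal (ennreal (real N * \<sigma>\<epsilon>\<^sup>2)) \<le> enn2ereal (\<Sum>k<N. loss u k)"
      by (simp add: less_eq_ennreal.rep_eq)
    then have "ereal (real N * \<sigma>\<epsilon>\<^sup>2) \<le> enn2ereal (\<Sum>k<N. loss u k)"
      by (simp add: enn2ereal_ennreal)
    then have "ereal (1 / real N) * ereal (real N * \<sigma>\<epsilon>\<^sup>2) \<le> ereal (1 / real N) * enn2ereal (\<Sum>k<N. loss u k)"
      by (rule ereal_mult_left_mono) simp
    then show ?case using elim by simp
  qed
qed

section \<open>Error recursion and average loss of the OLL estimates\<close>

text \<open>The convexity estimate turns the splitting of the next error into a scalar recursion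
  with factor \<open>r\<close> and a forcing term of order \<open>1 / Suc k\<close>. Square
  integrability is part of the conclusion so that the step can be iterated.\<close>

lemma oll_error_step:
  assumes oll: "oll_updates M w x y L u"
    and r: "0 \<le> r" "r < 1" and contr: "\<And>v. norm (v + L *v v) \<le> r * norm v"
    and l: "\<And>v. norm (L *v v) \<le> norm v * l"
    and C: "expectation (\<lambda>\<omega>. (norm (w \<omega> - moment_estimator (Suc k) \<omega>))\<^sup>2) \<le> C / real (Suc k)"
    and sq: "square_integrable M (\<lambda>\<omega>. estimate u k \<omega> - w \<omega>)"
  shows "square_integrable M (\<lambda>\<omega>. estimate u (Suc k) \<omega> - w \<omega>)"
    and "expectation (\<lambda>\<omega>. (norm (estimate u (Suc k) \<omega> - w \<omega>))\<^sup>2)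
      \<le> r * expectation (\<lambda>\<omega>. (norm (estimate u k \<omega> - w \<omega>))\<^sup>2)
        + (4 * l\<^sup>2 * C / (1 - r)) / real (Suc k)"
proof -
  let ?F = "information_algebra M x y u k"
  have adm: "admissible_updates M x y u" using oll by (simp add: oll_updates_def)
  interpret F: finite_measure_subalgebra M ?F
    by standard (rule information_algebra_subalgebra[OF adm])
  define e where "e \<omega> = estimate u k \<omega> - w \<omega>" for \<omega>
  define e' where "e' \<omega> = estimate u (Suc k) \<omega> - w \<omega>" for \<omega>
  define c where "c = vec_cond_exp M ?F e"
  \<comment> \<open>This is the comparison element for the conditional expectation of
    \<open>e\<close>: it is \<open>?F\<close>-measurable, and \<open>g - e\<close> is the error of
    the moment estimator. The index is \<open>Suc k\<close> because the information at time
    \<open>k\<close> holds the \<open>k + 1\<close> pairs from 0 to \<open>k\<close>.\<close>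
  define g where "g \<omega> = estimate u k \<omega> - moment_estimator (Suc k) \<omega>" for \<omega>
  have e: "square_integrable M e" using sq by (simp add: e_def[abs_def])
  have "(\<lambda>\<omega>. g \<omega> - e \<omega>) = (\<lambda>\<omega>. w \<omega> - moment_estimator (Suc k) \<omega>)"
    by (simp add: g_def e_def fun_eq_iff)
  then have ge: "square_integrable M (\<lambda>\<omega>. g \<omega> - e \<omega>)"
    using square_integrable_diff[OF parameter_square_integrable moment_estimator_square_integrable] by simp
  have g: "square_integrable M g"
    using square_integrable_add[OF ge e] by simp
  have gF: "g \<in> borel_measurable ?F"
  proof -
    have "estimate u k \<in> borel_measurable ?F"
      by (intro measurable_estimate measurable_information_components(3))
    moreover have "moment_estimator (Suc k) \<in> borel_measurable ?F"
      unfolding moment_estimator_def[abs_def]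
      by (intro measurable_compose[OF _ borel_measurable_continuous_onI[OF
            linear_continuous_on[OF matrix_vector_mul_bounded_linear]]]
          borel_measurable_scaleR borel_measurable_sum measurable_information_components(1,2)) auto
    ultimately show ?thesis unfolding g_def[abs_def] by (intro borel_measurable_diff)
  qed
  have ci: "c \<omega> $ i = real_cond_exp M ?F (\<lambda>\<omega>. e \<omega> $ i) \<omega>" for \<omega> i
    by (simp add: c_def vec_cond_exp_def)
  have c: "square_integrable M c"
    by (rule square_integrable_vecI)
      (simp add: ci F.square_integrable_real_cond_exp(1)[OF square_integrable_component[OF e]])
  define d where "d \<omega> = c \<omega> - e \<omega>" for \<omega>
  have d: "square_integrable M d" unfolding d_def[abs_def] by (rule square_integrable_diff[OF c e])
  have d_bound: "expectation (\<lambda>\<omega>. (norm (d \<omega>))\<^sup>2) \<le> 4 * C / real (Suc k)"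
  proof -
    have int: "integrable M (\<lambda>\<omega>. (f \<omega> $ i)\<^sup>2)" if "square_integrable M f" for f :: "'w \<Rightarrow> real^'n" and i
      using square_integrable_component[OF that] by (simp add: square_integrable_def)
    \<comment> \<open>The conditional expectation of a vector is taken by coordinates, so the scalar
      error estimate is applied to each coordinate and summed.\<close>
    have "expectation (\<lambda>\<omega>. (norm (d \<omega>))\<^sup>2) = (\<Sum>i\<in>UNIV. expectation (\<lambda>\<omega>. (d \<omega> $ i)\<^sup>2))"
      unfolding norm_power2_eq_sum by (rule Bochner_Integration.integral_sum) (rule int[OF d])
    also have "\<dots> \<le> (\<Sum>i\<in>UNIV. 4 * expectation (\<lambda>\<omega>. ((g \<omega> - e \<omega>) $ i)\<^sup>2))"
    proof (rule sum_mono)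
      fix i
      have "expectation (\<lambda>\<omega>. (real_cond_exp M ?F (\<lambda>\<omega>. e \<omega> $ i) \<omega> - e \<omega> $ i)\<^sup>2)
        \<le> 4 * expectation (\<lambda>\<omega>. (e \<omega> $ i - g \<omega> $ i)\<^sup>2)"
        by (intro F.real_cond_exp_error square_integrable_component e g component_measurable gF)
      then show "expectation (\<lambda>\<omega>. (d \<omega> $ i)\<^sup>2) \<le> 4 * expectation (\<lambda>\<omega>. ((g \<omega> - e \<omega>) $ i)\<^sup>2)"
        by (simp add: d_def ci power2_commute)
    qed
    also have "\<dots> = 4 * expectation (\<lambda>\<omega>. (norm (g \<omega> - e \<omega>))\<^sup>2)"
      unfolding norm_power2_eq_sum sum_distrib_left[symmetric]
      by (subst Bochner_Integration.integral_sum[OF int[OF ge]]) (rule refl)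
    also have "expectation (\<lambda>\<omega>. (norm (g \<omega> - e \<omega>))\<^sup>2) = expectation (\<lambda>\<omega>. (norm (w \<omega> - moment_estimator (Suc k) \<omega>))\<^sup>2)"
      by (simp add: g_def e_def)
    finally show ?thesis using C by simp
  qed
  have "AE \<omega> in M. u k \<omega> = L *v c \<omega>"
    using oll by (simp add: oll_updates_def c_def e_def[abs_def])
  \<comment> \<open>The update is fixed only up to a null set, so the splitting of \<open>e'\<close>
    holds almost everywhere.\<close>
  then have step: "AE \<omega> in M. e' \<omega> = (e \<omega> + L *v e \<omega>) + L *v d \<omega>"
    by eventually_elim (simp add: e'_def e_def d_def matrix_vector_mult_diff_distrib)
  have meas: "e' \<in> borel_measurable M" unfolding e'_def[abs_def]
    by (intro borel_measurable_diff estimate_borel_measurable[OF adm] w_measurable)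
  have "square_integrable M (\<lambda>\<omega>. (e \<omega> + L *v e \<omega>) + L *v d \<omega>)"
    by (intro square_integrable_add e d square_integrable_bounded_linear[OF matrix_vector_mul_bounded_linear])
  then have e': "square_integrable M e'"
    by (rule square_integrable_dominated[OF meas, where C=1]) (use step in auto)
  then show "square_integrable M (\<lambda>\<omega>. estimate u (Suc k) \<omega> - w \<omega>)" by (simp add: e'_def[abs_def])
  have int: "integrable M (\<lambda>\<omega>. (norm (e \<omega>))\<^sup>2)" "integrable M (\<lambda>\<omega>. (norm (d \<omega>))\<^sup>2)"
    "integrable M (\<lambda>\<omega>. (norm (e' \<omega>))\<^sup>2)"
    using e d e' by (auto simp: square_integrable_def)
  have "expectation (\<lambda>\<omega>. (norm (e' \<omega>))\<^sup>2)
    \<le> expectation (\<lambda>\<omega>. r * (norm (e \<omega>))\<^sup>2 + l\<^sup>2 / (1 - r) * (norm (d \<omega>))\<^sup>2)"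
  proof (rule integral_mono_AE)
    show "AE \<omega> in M. (norm (e' \<omega>))\<^sup>2 \<le> r * (norm (e \<omega>))\<^sup>2 + l\<^sup>2 / (1 - r) * (norm (d \<omega>))\<^sup>2"
      using step
    proof eventually_elim
      case (elim \<omega>)
      have "(norm (e' \<omega>))\<^sup>2 \<le> r * (norm (e \<omega>))\<^sup>2 + (norm (L *v d \<omega>))\<^sup>2 / (1 - r)"
        unfolding elim by (rule norm_add_contraction_power2[OF r contr]) simp
      also have "(norm (L *v d \<omega>))\<^sup>2 \<le> (norm (d \<omega>) * l)\<^sup>2" by (intro power_mono l) simp
      finally show ?case using r by (simp add: divide_right_mono power_mult_distrib mult.commute)
    qed
  qed (use int in auto)
  also have "\<dots> = r * expectation (\<lambda>\<omega>. (norm (e \<omega>))\<^sup>2) + l\<^sup>2 / (1 - r) * expectation (\<lambda>\<omega>. (norm (d \<omega>))\<^sup>2)"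
    using int by simp
  also have "\<dots> \<le> r * expectation (\<lambda>\<omega>. (norm (e \<omega>))\<^sup>2) + l\<^sup>2 / (1 - r) * (4 * C / real (Suc k))"
    using r by (intro add_left_mono mult_left_mono d_bound) auto
  finally show "expectation (\<lambda>\<omega>. (norm (estimate u (Suc k) \<omega> - w \<omega>))\<^sup>2)
      \<le> r * expectation (\<lambda>\<omega>. (norm (estimate u k \<omega> - w \<omega>))\<^sup>2)
        + (4 * l\<^sup>2 * C / (1 - r)) / real (Suc k)"
    by (simp add: e_def e'_def mult_ac)
qed

text \<open>By Cauchy-Schwarz and the bound \<open>B\<close> on the inputs, each loss exceeds the
  noise variance by at most \<open>B\<^sup>2\<close> times the mean square error, and the averages
  of the latter vanish.\<close>

lemma oll_average_loss_le:
  assumes oll: "oll_updates M w x y L u"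
    and r: "0 \<le> r" "r < 1" and contr: "\<And>v. norm (v + L *v v) \<le> r * norm v"
  shows "average_loss M x y (estimate u) \<le> ereal (\<sigma>\<epsilon>\<^sup>2)"
proof -
  have adm: "admissible_updates M x y u" using oll by (simp add: oll_updates_def)
  obtain l where l: "\<And>v. norm (L *v v) \<le> norm v * l"
    using bounded_linear.bounded[OF matrix_vector_mul_bounded_linear[of L]] by blast
  obtain C where C: "\<And>n. n > 0 \<Longrightarrow> expectation (\<lambda>\<omega>. (norm (w \<omega> - moment_estimator n \<omega>))\<^sup>2) \<le> C / real n"
    using moment_estimator_error_bound by blast
  note step = oll_error_step[OF oll r contr l C[OF zero_less_Suc]]
  \<comment> \<open>The induction starts from the error \<open>- w\<close> of the zero
    estimate.\<close>
  have sq: "square_integrable M (\<lambda>\<omega>. estimate u k \<omega> - w \<omega>)" for k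
    by (induction k) (auto intro: step(1) square_integrable_minus parameter_square_integrable
      simp del: estimate.simps(2))
  define a where "a k = expectation (\<lambda>\<omega>. (norm (estimate u k \<omega> - w \<omega>))\<^sup>2)" for k
  have avg: "(\<lambda>N. (\<Sum>k<N. a k) / real N) \<longlonglongrightarrow> 0"
    by (rule contraction_average_tendsto_0[OF r]) (unfold a_def, simp, rule step(2)[OF sq])
  obtain B where B: "0 \<le> B" "\<And>k. AE \<omega> in M. norm (x k \<omega>) \<le> B" using input_bounded by blast
  have loss: "loss u k \<le> ennreal (B\<^sup>2 * a k + \<sigma>\<epsilon>\<^sup>2)" for k
  proof -
    have "(\<integral>\<^sup>+\<omega>. ennreal (((estimate u k \<omega> - w \<omega>) \<bullet> x k \<omega>)\<^sup>2) \<partial>M)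
      \<le> (\<integral>\<^sup>+\<omega>. ennreal (B\<^sup>2 * (norm (estimate u k \<omega> - w \<omega>))\<^sup>2) \<partial>M)"
    proof (rule nn_integral_mono_AE)
      show "AE \<omega> in M. ennreal (((estimate u k \<omega> - w \<omega>) \<bullet> x k \<omega>)\<^sup>2)
        \<le> ennreal (B\<^sup>2 * (norm (estimate u k \<omega> - w \<omega>))\<^sup>2)"
        using B(2)[of k]
      proof eventually_elim
        case (elim \<omega>)
        have "\<bar>(estimate u k \<omega> - w \<omega>) \<bullet> x k \<omega>\<bar> \<le> norm (estimate u k \<omega> - w \<omega>) * norm (x k \<omega>)"
          by (rule Cauchy_Schwarz_ineq2)
        also have "\<dots> \<le> norm (estimate u k \<omega> - w \<omega>) * B" using elim by (intro mult_left_mono) auto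
        finally have "\<bar>(estimate u k \<omega> - w \<omega>) \<bullet> x k \<omega>\<bar>\<^sup>2 \<le> (norm (estimate u k \<omega> - w \<omega>) * B)\<^sup>2"
          by (intro power_mono) auto
        then show ?case by (intro ennreal_leI) (simp add: power_mult_distrib mult.commute)
      qed
    qed
    also have "\<dots> = ennreal (B\<^sup>2 * a k)"
      unfolding a_def using sq[of k]
      by (subst nn_integral_eq_integral) (auto simp: square_integrable_def)
    finally have "loss u k \<le> ennreal (B\<^sup>2 * a k) + ennreal (\<sigma>\<epsilon>\<^sup>2)"
      unfolding loss_eq[OF adm] by (rule add_right_mono)
    then show ?thesis by (simp add: ennreal_plus a_def)
  qed
  define b where "b N = B\<^sup>2 * ((\<Sum>k<N. a k) / real N) + \<sigma>\<epsilon>\<^sup>2" for N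
  have "average_loss M x y (estimate u) \<le> liminf (\<lambda>N. ereal (b N))"
    unfolding average_loss_def sum_loss[OF adm]
  proof (rule Liminf_mono)
    show "\<forall>\<^sub>F N in sequentially. ereal (1 / real N) * enn2ereal (\<Sum>k<N. loss u k) \<le> ereal (b N)"
      using eventually_gt_at_top[of 0]
    proof eventually_elim
      case (elim N)
      have "(\<Sum>k<N. loss u k) \<le> (\<Sum>k<N. ennreal (B\<^sup>2 * a k + \<sigma>\<epsilon>\<^sup>2))"
        by (rule sum_mono) (rule loss)
      also have "\<dots> = ennreal (\<Sum>k<N. B\<^sup>2 * a k + \<sigma>\<epsilon>\<^sup>2)"
        by (subst sum_ennreal) (auto simp: a_def)
      also have "(\<Sum>k<N. B\<^sup>2 * a k + \<sigma>\<epsilon>\<^sup>2) = real N * b N"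
        using elim by (simp add: b_def sum.distrib distrib_left flip: sum_distrib_left)
      finally have "enn2ereal (\<Sum>k<N. loss u k) \<le> enn2ereal (ennreal (real N * b N))"
        by (simp add: less_eq_ennreal.rep_eq)
      also have "\<dots> = ereal (real N * b N)"
        by (rule enn2ereal_ennreal) (auto simp: b_def a_def intro!: mult_nonneg_nonneg add_nonneg_nonneg
          divide_nonneg_nonneg sum_nonneg)
      finally have "ereal (1 / real N) * enn2ereal (\<Sum>k<N. loss u k) \<le> ereal (1 / real N) * ereal (real N * b N)"
        by (rule ereal_mult_left_mono) simp
      then show ?case using elim by simp
    qed
  qed
  also have "liminf (\<lambda>N. ereal (b N)) = ereal (\<sigma>\<epsilon>\<^sup>2)"
  proof (rule lim_imp_Liminf)
    have "(\<lambda>N. B\<^sup>2 * ((\<Sum>k<N. a k) / real N) + \<sigma>\<epsilon>\<^sup>2) \<longlonglongrightarrow> B\<^sup>2 * 0 + \<sigma>\<epsilon>\<^sup>2"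
      by (intro tendsto_intros avg)
    then show "(\<lambda>N. ereal (b N)) \<longlonglongrightarrow> ereal (\<sigma>\<epsilon>\<^sup>2)" by (simp add: b_def[abs_def])
  qed simp
  finally show ?thesis .
qed

end

section \<open>Minimality of the average regret of the OLL estimates\<close>

theorem proposition7:
  fixes M :: "'w measure"
    and w :: "'w \<Rightarrow> real^'n"
    and x :: "nat \<Rightarrow> 'w \<Rightarrow> real^'n"
    and \<epsilon> :: "nat \<Rightarrow> 'w \<Rightarrow> real"
    and \<Sigma>w Q K L :: "real^'n^'n"
    and \<sigma>\<epsilon> \<gamma> :: real
    and y :: "nat \<Rightarrow> 'w \<Rightarrow> real"
  assumes model: "data_model M w x \<epsilon> \<Sigma>w \<sigma>\<epsilon> Q"
    and y: "y = outputs w x \<epsilon>"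
    and gamma: "\<gamma> > 0"
    and K_psd: "pos_semidef K"
    and K_riccati: "K = K - K ** matrix_inv (K + \<gamma> *\<^sub>R mat 1) ** K + Q"
    and L: "L = oll_gain \<gamma> K"
  shows "(\<exists>u. oll_updates M w x y L u) \<and>
    (\<forall>u v. oll_updates M w x y L u \<longrightarrow> admissible_updates M x y v \<longrightarrow>
       average_regret M w x y (estimate u) \<le> average_regret M w x y (estimate v))"
proof -
  interpret data_model M w x \<epsilon> \<Sigma>w \<sigma>\<epsilon> Q by (rule model)
  obtain r where r: "0 \<le> r" "r < 1" "\<And>v. norm (v + L *v v) \<le> r * norm v"
    using riccati_gain_contraction[OF gamma K_psd Q_pos_def K_riccati] unfolding L by blast
  \<comment> \<open>Both regrets subtract the same benchmark, the average loss of \<open>w\<close>,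
    so it suffices that \<open>\<sigma>\<epsilon>\<^sup>2\<close> separates the two average
    losses.\<close>
  have "average_regret M w x y (estimate u) \<le> average_regret M w x y (estimate v)"
    if "oll_updates M w x y L u" "admissible_updates M x y v" for u v
    unfolding average_regret_def
    using oll_average_loss_le[OF that(1)[unfolded y] r] average_loss_ge[OF that(2)[unfolded y]]
    unfolding y by (intro ereal_minus_mono order_refl) (rule order_trans)
  \<comment> \<open>The existence of OLL updates keeps the minimality claim from being
    vacuous.\<close>
  then show ?thesis using ex_oll_updates by blast
qed

end
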